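(* Let $\chi$ be a real non-principal Dirichlet character modulo $k$, and let $g:\mathbb{N}\to\{-1,1\}$ be a completely multiplicative extension of $\chi$, i.e. $g$ is completely multiplicative, $g(n)=\chi(n)$ whenever $\gcd(n,k)=1$, and $g(p)\in\{-1,1\}$ for each prime $p\mid k$. Let $f=\mu^2 g$. Assume that all zeros of $L(s,\chi)$ in the half plane $\{s\in\mathbb{C}:\operatorname{Re}s>0\}$ have real part equal to $1/2$. If $M_f(x)=o(x^{\alpha})$ for some $\alpha>0$, then: (i) $\alpha\geq 1/4$; (ii) the Riemann zeta function $\zeta$ has no zeros in the half plane $\{s\in\mathbb{C}:\operatorname{Re}s>2\alpha\}$.
   Context: $\mu$ is the Möbius function, so $\mu^2$ is the indicator function of the squarefree integers. $M_f(x):=\sum_{n\leq x}f(n)$. $L(s,\chi)=\sum_{n\ge1}\chi(n)n^{-s}$ is the Dirichlet $L$-function of $\chi$. *)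

theory Defs
  imports
    "HOL-Complex_Analysis.Complex_Analysis"
    "HOL-Number_Theory.Number_Theory"
    "HOL-Computational_Algebra.Squarefree"
    "HOL-Library.Landau_Symbols"
begin

section \<open>Arithmetic functions\<close>

definition dirichlet_character :: "nat \<Rightarrow> (nat \<Rightarrow> complex) \<Rightarrow> bool" where
  "dirichlet_character k chi \<longleftrightarrow>
     k > 0 \<and>
     (\<forall>n. chi (n + k) = chi n) \<and>
     (\<forall>m n. chi (m * n) = chi m * chi n) \<and>
     (\<forall>n. chi n \<noteq> 0 \<longleftrightarrow> coprime n k)"

definition principal_character :: "nat \<Rightarrow> nat \<Rightarrow> complex" where
  "principal_character k n = (if coprime n k then 1 else 0)"

definition real_character :: "(nat \<Rightarrow> complex) \<Rightarrow> bool" where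
  "real_character chi \<longleftrightarrow> (\<forall>n. chi n \<in> \<real>)"

text \<open>Arithmetic functions live on the positive integers; their value at 0 is irrelevant.\<close>

definition completely_multiplicative :: "(nat \<Rightarrow> real) \<Rightarrow> bool" where
  "completely_multiplicative g \<longleftrightarrow>
     g 1 = 1 \<and> (\<forall>m>0. \<forall>n>0. g (m * n) = g m * g n)"

definition sign_extension :: "nat \<Rightarrow> (nat \<Rightarrow> complex) \<Rightarrow> (nat \<Rightarrow> real) \<Rightarrow> bool" where
  "sign_extension k chi g \<longleftrightarrow>
     completely_multiplicative g \<and>
     (\<forall>n>0. g n \<in> {-1, 1}) \<and>
     (\<forall>n>0. coprime n k \<longrightarrow> of_real (g n) = chi n)"

definition moebius_mu :: "nat \<Rightarrow> real" where
  "moebius_mu n = (if squarefree n then (-1) ^ card (prime_factors n) else 0)"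

lemma moebius_mu_squared: "(moebius_mu n)\<^sup>2 = (if squarefree n then 1 else 0)"
  by (simp add: moebius_mu_def flip: power_mult)

definition summatory :: "(nat \<Rightarrow> real) \<Rightarrow> real \<Rightarrow> real" where
  "summatory f x = (\<Sum>n | 0 < n \<and> real n \<le> x. f n)"


section \<open>Dirichlet series and the Riemann zeta function\<close>

text \<open>
  The sum is over positive integers and is an ordinary, possibly only conditionally convergent,
  series. For a non-principal character it converges for all \<open>s\<close> with positive real part, so
  there the sum is the value of the \<open>L\<close>-function and no continuation is needed.
\<close>

definition dirichlet_series :: "(nat \<Rightarrow> complex) \<Rightarrow> complex \<Rightarrow> complex" where
  "dirichlet_series a s = (\<Sum>n. a (Suc n) * of_nat (Suc n) powr (-s))"

definition dirichlet_L :: "(nat \<Rightarrow> complex) \<Rightarrow> complex \<Rightarrow> complex" where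
  "dirichlet_L chi s = dirichlet_series chi s"

text \<open>
  The zeta function is the analytic continuation of its Dirichlet series to the plane without
  the pole at 1. Its value at 1 is unspecified. Existence and uniqueness of the
  continuation are proved below.
\<close>

definition is_zeta_continuation :: "(complex \<Rightarrow> complex) \<Rightarrow> bool" where
  "is_zeta_continuation F \<longleftrightarrow>
     F holomorphic_on (- {1}) \<and> (\<forall>s. Re s > 1 \<longrightarrow> F s = dirichlet_series (\<lambda>_. 1) s)"

definition riemann_zeta :: "complex \<Rightarrow> complex" where
  "riemann_zeta = (SOME F. is_zeta_continuation F)"


subsection \<open>Existence of the continuation\<close>

text \<open>
  Integrating by parts repeatedly in the sums \<open>\<Sum>n. \<integral>\<^sub>0\<^sup>1 p(x) (n + x)\<^sup>-\<^sup>s dx\<close> moves the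
  half plane of holomorphy one unit to the left at each step.
\<close>

definition node :: "nat \<Rightarrow> real \<Rightarrow> complex" where
  "node n x = of_real (real (Suc n) + x)"

lemma Re_node [simp]: "Re (node n x) = real (Suc n) + x" and Im_node [simp]: "Im (node n x) = 0"
  by (simp_all add: node_def)

lemma node_0: "node n 0 = of_nat (Suc n)"
  by (simp add: node_def)

lemma node_1: "node n 1 = of_nat (Suc (Suc n))"
  by (simp add: node_def)

lemma node_not_nonpos: "x \<ge> 0 \<Longrightarrow> node n x \<notin> \<real>\<^sub>\<le>\<^sub>0"
  by (auto simp: node_def complex_nonpos_Reals_iff simp del: of_real_add)

lemma node_nonzero: "x \<ge> 0 \<Longrightarrow> node n x \<noteq> 0"
  using node_not_nonpos[of x n] by auto

lemma continuous_on_node [continuous_intros]: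
  "continuous_on A f \<Longrightarrow> continuous_on A (\<lambda>x. node n (f x))"
  unfolding node_def by (intro continuous_intros)

lemma norm_node_powr: "x \<ge> 0 \<Longrightarrow> norm (node n x powr s) = (real (Suc n) + x) powr Re s"
  by (subst norm_powr_real_powr) (auto simp: node_def)

definition zint :: "(real \<Rightarrow> complex) \<Rightarrow> nat \<Rightarrow> complex \<Rightarrow> complex" where
  "zint p n s = integral {0..1} (\<lambda>x. p x * node n x powr (-s))"

lemma powr_continuous:
  "continuous_on {0..1} (\<lambda>x. node n x powr (-s))"
  by (intro continuous_intros) (auto simp: node_nonzero node_not_nonpos)

lemma powr_vector_derivative:
  assumes "x \<in> {0..1::real}"
  shows "((\<lambda>x. node n x powr w) has_vector_derivative
            w * node n x powr (w - 1)) (at x within {0..1})"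
proof -
  have *: "node n x \<notin> \<real>\<^sub>\<le>\<^sub>0"
    using assms by (intro node_not_nonpos) auto
  have "((\<lambda>x. node n x) has_vector_derivative 1) (at x within {0..1})"
    unfolding node_def of_real_add
    by (auto intro!: derivative_eq_intros simp: has_vector_derivative_of_real)
  from field_vector_diff_chain_within[OF this
      has_field_derivative_at_within[OF has_field_derivative_powr[OF *, of w]]]
  show ?thesis by (simp add: o_def)
qed

lemma zint_integrable:
  assumes "continuous_on {0..1} p"
  shows "(\<lambda>x. p x * node n x powr (-s)) integrable_on {0..1::real}"
  by (intro integrable_continuous_interval continuous_on_mult assms powr_continuous)

lemma zint_holomorphic:
  assumes "continuous_on {0..1} p"
  shows "zint p n holomorphic_on UNIV"
proof -
  have "(\<lambda>s. integral (cbox 0 (1::real)) (\<lambda>x. p x * node n x powr (-s)))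
          holomorphic_on UNIV"
  proof (rule leibniz_rule_holomorphic)
    fix s :: complex and x :: real assume x: "x \<in> cbox 0 1"
    have nz: "node n x \<noteq> 0"
      using x by (intro node_nonzero) auto
    show "((\<lambda>s. p x * node n x powr (-s)) has_field_derivative
        p x * (- Ln (node n x) * node n x powr (-s)))
        (at s within UNIV)"
    proof -
      have "((\<lambda>s. node n x powr (-s)) has_field_derivative Ln (node n x) * node n x powr (-s) * (-1))
          (at s)"
        by (rule DERIV_chain2[OF has_field_derivative_powr_right[OF nz]])
           (auto intro!: derivative_eq_intros)
      from DERIV_cmult[OF this, of "p x"] show ?thesis by simp
    qed
  next
    have "continuous_on (UNIV \<times> cbox 0 1) (\<lambda>z::complex \<times> real. p (snd z))"
      by (rule continuous_on_compose2[OF assms continuous_on_snd]) (auto intro: continuous_intros)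
    thus "continuous_on (UNIV \<times> cbox 0 1) (\<lambda>(s, x).
        p x * (- Ln (node n x) * node n x powr (-s)))"
      unfolding case_prod_unfold
      by (intro continuous_intros) (auto simp: node_nonzero node_not_nonpos)
  qed (use zint_integrable[OF assms] in auto)
  thus ?thesis by (simp add: zint_def[abs_def])
qed

lemma zint_bound:
  assumes "continuous_on {0..1} p"
  obtains B where "B \<ge> 0" "\<And>n s. Re s \<ge> 0 \<Longrightarrow> norm (zint p n s) \<le> B * real (Suc n) powr (- Re s)"
proof -
  have "compact (p ` {0..1})" using assms by (intro compact_continuous_image) auto
  then obtain B where B: "\<And>x. x \<in> {0..1} \<Longrightarrow> norm (p x) \<le> B" "B > 0"
    using compact_imp_bounded[THEN bounded_pos[THEN iffD1]] by (metis imageI)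
  have "norm (zint p n s) \<le> B * real (Suc n) powr (- Re s)" if s: "Re s \<ge> 0" for n s
  proof -
    have "norm (integral {0..1::real} (\<lambda>x. p x * node n x powr (-s)))
        \<le> (B * real (Suc n) powr (- Re s)) * (1 - 0)"
    proof (rule integral_bound)
      fix x :: real assume x: "x \<in> {0..1}"
      have "norm (node n x powr (-s)) = (real (Suc n) + x) powr (- Re s)"
        using x by (subst norm_node_powr) auto
      also have "\<dots> \<le> real (Suc n) powr (- Re s)"
        using x s by (intro powr_mono2') auto
      finally show "norm (p x * node n x powr (-s)) \<le> B * real (Suc n) powr (- Re s)"
        unfolding norm_mult using B(1)[OF x] B(2) by (intro mult_mono) auto
    qed (use assms in \<open>auto intro!: continuous_on_mult powr_continuous\<close>)
    thus ?thesis by (simp add: zint_def)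
  qed
  with B(2) show ?thesis by (intro that[of B]) auto
qed

lemma summable_Suc_powr: "a > 1 \<Longrightarrow> summable (\<lambda>n. real (Suc n) powr (-a))"
  by (subst summable_Suc_iff[of "\<lambda>n. real n powr (-a)"]) (simp add: summable_real_powr_iff)

lemma zint_summable:
  assumes "continuous_on {0..1} p" "Re s > 1"
  shows "summable (\<lambda>n. zint p n s)"
proof -
  obtain B where "B \<ge> 0" "\<And>n s. Re s \<ge> 0 \<Longrightarrow> norm (zint p n s) \<le> B * real (Suc n) powr (- Re s)"
    using zint_bound[OF assms(1)] by blast
  thus ?thesis using assms(2)
    by (intro summable_comparison_test'[OF summable_mult[OF summable_Suc_powr[of "Re s"], of B]]) auto
qed

lemma zint_suminf_holomorphic:
  assumes "continuous_on {0..1} p"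
  shows "(\<lambda>s. \<Sum>n. zint p n s) holomorphic_on {s. Re s > 1}"
proof (rule holomorphic_uniform_sequence)
  show "open {s. Re s > 1}" by (rule open_halfspace_Re_gt)
  show "(\<lambda>s. \<Sum>i<n. zint p i s) holomorphic_on {s. Re s > 1}" for n
    using zint_holomorphic[OF assms] by (intro holomorphic_intros) (auto intro: holomorphic_on_subset)
next
  fix z assume "z \<in> {s. Re s > 1}"
  hence z: "Re z > 1" by simp
  define d where "d = (Re z - 1) / 2"
  have d: "d > 0" using z by (simp add: d_def)
  have Re: "Re s \<ge> 1 + d" if "s \<in> cball z d" for s
    using abs_Re_le_cmod[of "z - s"] that by (auto simp: dist_norm d_def field_simps)
  obtain B where B: "B \<ge> 0" "\<And>n s. Re s \<ge> 0 \<Longrightarrow> norm (zint p n s) \<le> B * real (Suc n) powr (- Re s)"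
    using zint_bound[OF assms(1)] by blast
  have "uniform_limit (cball z d) (\<lambda>n s. \<Sum>i<n. zint p i s) (\<lambda>s. \<Sum>i. zint p i s) sequentially"
  proof (rule Weierstrass_m_test)
    fix n s assume s: "s \<in> cball z d"
    have "norm (zint p n s) \<le> B * real (Suc n) powr (- Re s)"
      using Re[OF s] d by (intro B) auto
    also have "\<dots> \<le> B * real (Suc n) powr (- (1 + d))"
      using Re[OF s] by (intro mult_left_mono powr_mono B) auto
    finally show "norm (zint p n s) \<le> B * real (Suc n) powr (- (1 + d))" .
  qed (intro summable_mult summable_Suc_powr, use d in auto)
  moreover have "cball z d \<subseteq> {s. Re s > 1}" using Re d by fastforce
  ultimately show "\<exists>d. 0 < d \<and> cball z d \<subseteq> {s. Re s > 1} \<and>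
      uniform_limit (cball z d) (\<lambda>n s. \<Sum>i<n. zint p i s) (\<lambda>s. \<Sum>i. zint p i s) sequentially"
    using d by blast
qed

lemma zint_by_parts:
  assumes "continuous_on {0..1} p"
    and P: "\<And>x. x \<in> {0..1} \<Longrightarrow> (P has_vector_derivative p x) (at x within {0..1})"
  shows "zint p n s = P 1 * node n 1 powr (-s) - P 0 * node n 0 powr (-s)
           + s * zint P n (s + 1)"
proof -
  have contP: "continuous_on {0..1} P"
    using P by (meson continuous_on_vector_derivative)
  have "((\<lambda>x. P x * (-s * node n x powr (-s - 1)) + p x * node n x powr (-s))
      has_integral P 1 * node n 1 powr (-s) - P 0 * node n 0 powr (-s)) {0..1}"
    by (rule fundamental_theorem_of_calculus,
        simp, intro has_vector_derivative_mult P powr_vector_derivative)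
  moreover have "((\<lambda>x. s * (P x * node n x powr (- (s + 1)))) has_integral s * zint P n (s + 1)) {0..1}"
    unfolding zint_def by (intro has_integral_mult_right integrable_integral zint_integrable contP)
  ultimately have "((\<lambda>x. (P x * (-s * node n x powr (-s - 1)) + p x * node n x powr (-s))
        + s * (P x * node n x powr (- (s + 1))))
      has_integral (P 1 * node n 1 powr (-s) - P 0 * node n 0 powr (-s))
        + s * zint P n (s + 1)) {0..1}"
    by (rule has_integral_add)
  moreover have "(P x * (-s * node n x powr (-s - 1)) + p x * node n x powr (-s))
        + s * (P x * node n x powr (- (s + 1))) = p x * node n x powr (-s)" for x
  proof -
    have "- (s + 1) = -s - 1" by simp
    thus ?thesis by (simp only:) (simp add: algebra_simps)
  qed
  ultimately show ?thesis by (simp add: zint_def integral_unique)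
qed

lemma zint_one_sums:
  assumes s: "Re s > 1"
  shows "(\<lambda>n. zint (\<lambda>_. 1) n s) sums (1 / (s - 1))"
proof -
  define F where "F n = of_nat (Suc n) powr (1 - s) / (s - 1)" for n
  have "s \<noteq> 1" using s by auto
  have "zint (\<lambda>_. 1) n s = F n - F (Suc n)" for n
  proof -
    have "((\<lambda>x. 1 / (1 - s) * ((1 - s) * node n x powr (1 - s - 1))) has_integral
        1 / (1 - s) * node n 1 powr (1 - s)
        - 1 / (1 - s) * node n 0 powr (1 - s)) {0..1}"
      by (rule fundamental_theorem_of_calculus,
          simp, intro has_vector_derivative_mult_right powr_vector_derivative)
    hence "zint (\<lambda>_. 1) n s = 1 / (1 - s) * node n 1 powr (1 - s)
        - 1 / (1 - s) * node n 0 powr (1 - s)"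
      using \<open>s \<noteq> 1\<close> by (simp add: zint_def integral_unique)
    also have "\<dots> = F n - F (Suc n)"
      using \<open>s \<noteq> 1\<close> by (simp add: F_def node_0 node_1 field_simps)
    finally show ?thesis .
  qed
  moreover have "F \<longlonglongrightarrow> 0"
  proof (rule tendsto_norm_zero_cancel)
    have "filterlim (\<lambda>n. real (Suc n)) at_top sequentially"
      by (rule filterlim_compose[OF filterlim_real_sequentially filterlim_Suc])
    hence "(\<lambda>n. real (Suc n) powr (1 - Re s)) \<longlonglongrightarrow> 0"
      using s by (intro tendsto_neg_powr) auto
    hence "(\<lambda>n. real (Suc n) powr (1 - Re s) / norm (s - 1)) \<longlonglongrightarrow> 0 / norm (s - 1)"
      using \<open>s \<noteq> 1\<close> by (intro tendsto_divide tendsto_const) auto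
    moreover have "norm (F n) = real (Suc n) powr (1 - Re s) / norm (s - 1)" for n
      unfolding F_def norm_divide by (subst norm_powr_real_powr) auto
    ultimately show "(\<lambda>n. norm (F n)) \<longlonglongrightarrow> 0" by simp
  qed
  ultimately show ?thesis
    using telescope_sums'[of F 0] by (simp add: F_def)
qed

lemma zint_continuation_step:
  assumes p: "continuous_on {0..1} p"
  obtains P m where "continuous_on {0..1} P"
    "\<And>s. Re s > 1 \<Longrightarrow> (\<Sum>n. zint p n s) = m / (s - 1) + s * (\<Sum>n. zint P n (s + 1))"
proof -
  define m where "m = integral {0..1} p"
  define P where "P = (\<lambda>u. integral {0..u} (\<lambda>x. p x - m))"
  have pm: "continuous_on {0..1} (\<lambda>x. p x - m)" by (intro continuous_intros p)
  have P': "(P has_vector_derivative p x - m) (at x within {0..1})" if "x \<in> {0..1}" for x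
    unfolding P_def using integral_has_vector_derivative[OF pm that] .
  have "integral {0..1} (\<lambda>x. p x - m) = integral {0..1} p - integral {0..1::real} (\<lambda>_. m)"
    by (intro Henstock_Kurzweil_Integration.integral_diff integrable_continuous_interval p
        continuous_on_const)
  hence P01: "P 0 = 0" "P 1 = 0"
    by (simp_all add: P_def m_def)
  have contP: "continuous_on {0..1} P"
    using P' by (meson continuous_on_vector_derivative)
  have "(\<Sum>n. zint p n s) = m / (s - 1) + s * (\<Sum>n. zint P n (s + 1))" if s: "Re s > 1" for s
  proof -
    have "zint p n s = m * zint (\<lambda>_. 1) n s + s * zint P n (s + 1)" for n
    proof -
      have "zint (\<lambda>x. p x - m) n s = zint p n s - m * zint (\<lambda>_. 1) n s"
        using zint_integrable[OF p, of n s] zint_integrable[of "\<lambda>_. 1" n s]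
        by (simp add: zint_def left_diff_distrib Henstock_Kurzweil_Integration.integral_diff
              integrable_on_mult_right)
      thus ?thesis using zint_by_parts[OF pm P', of n s] P01 by (simp add: algebra_simps)
    qed
    moreover have "(\<lambda>n. m * zint (\<lambda>_. 1) n s + s * zint P n (s + 1)) sums
        (m * (1 / (s - 1)) + s * (\<Sum>n. zint P n (s + 1)))"
      using s by (intro sums_add sums_mult zint_one_sums summable_sums zint_summable contP) auto
    ultimately show ?thesis by (simp add: sums_iff)
  qed
  thus ?thesis using contP by (intro that[of P m])
qed

lemma zint_continuation:
  assumes "continuous_on {0..1} p"
  shows "\<exists>m h. h holomorphic_on {s. Re s > 1 - real N} \<and>
           (\<forall>s. Re s > 1 \<longrightarrow> (\<Sum>n. zint p n s) = m / (s - 1) + h s)"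
  using assms
proof (induction N arbitrary: p)
  case 0
  thus ?case using zint_suminf_holomorphic[of p]
    by (intro exI[of _ 0] exI[of _ "\<lambda>s. \<Sum>n. zint p n s"]) auto
next
  case (Suc N)
  from zint_continuation_step[OF Suc.prems] obtain P m where P: "continuous_on {0..1} P"
    "\<And>s. Re s > 1 \<Longrightarrow> (\<Sum>n. zint p n s) = m / (s - 1) + s * (\<Sum>n. zint P n (s + 1))" by blast
  from Suc.IH[OF P(1)] obtain m' h where h: "h holomorphic_on {s. Re s > 1 - real N}"
    "\<And>s. Re s > 1 \<Longrightarrow> (\<Sum>n. zint P n s) = m' / (s - 1) + h s" by blast
  have "(\<lambda>s. m' + s * (h \<circ> (\<lambda>s. s + 1)) s) holomorphic_on {s. Re s > 1 - real (Suc N)}"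
    by (intro holomorphic_intros holomorphic_on_compose_gen[OF _ h(1)]) auto
  moreover have "(\<Sum>n. zint p n s) = m / (s - 1) + (m' + s * (h \<circ> (\<lambda>s. s + 1)) s)" if "Re s > 1" for s
  proof -
    have "s \<noteq> 0" using that by auto
    thus ?thesis using P(2)[OF that] h(2)[of "s + 1"] that by (simp add: algebra_simps)
  qed
  ultimately show ?case by blast
qed

lemma zeta_continuation_halfplane:
  "\<exists>h. h holomorphic_on {s. Re s > - real N} \<and>
       (\<forall>s. Re s > 1 \<longrightarrow> dirichlet_series (\<lambda>_. 1) s = 1 / (s - 1) + h s)"
proof -
  define P where "P = (\<lambda>x. complex_of_real x - 1)"
  have contP: "continuous_on {0..1} P" unfolding P_def by (intro continuous_intros)
  obtain m h where h: "h holomorphic_on {s. Re s > 1 - real N}"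
    "\<And>s. Re s > 1 \<Longrightarrow> (\<Sum>n. zint P n s) = m / (s - 1) + h s"
    using zint_continuation[OF contP, of N] by blast
  have "(\<lambda>s. - m - s * (h \<circ> (\<lambda>s. s + 1)) s) holomorphic_on {s. Re s > - real N}"
    by (intro holomorphic_intros holomorphic_on_compose_gen[OF _ h(1)]) auto
  moreover have "dirichlet_series (\<lambda>_. 1) s = 1 / (s - 1) + (- m - s * (h \<circ> (\<lambda>s. s + 1)) s)"
    if s: "Re s > 1" for s
  proof -
    have P': "(P has_vector_derivative 1) (at x within {0..1})" for x
      unfolding P_def by (auto intro!: derivative_eq_intros simp: has_vector_derivative_of_real)
    have "1 * of_nat (Suc n) powr (-s) = zint (\<lambda>_. 1) n s - s * zint P n (s + 1)" for n
      using zint_by_parts[OF _ P', of n s] by (simp add: P_def node_0)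
    hence "dirichlet_series (\<lambda>_. 1) s = (\<Sum>n. zint (\<lambda>_. 1) n s - s * zint P n (s + 1))"
      by (simp add: dirichlet_series_def)
    also have "\<dots> = 1 / (s - 1) - s * (\<Sum>n. zint P n (s + 1))"
      using s by (intro sums_unique[symmetric] sums_diff sums_mult zint_one_sums summable_sums
          zint_summable contP) auto
    also have "(\<Sum>n. zint P n (s + 1)) = m / s + h (s + 1)"
      using h(2)[of "s + 1"] s by simp
    also have "1 / (s - 1) - s * (m / s + h (s + 1)) = 1 / (s - 1) + (- m - s * (h \<circ> (\<lambda>s. s + 1)) s)"
    proof -
      have "s \<noteq> 0" using s by auto
      thus ?thesis by (simp add: algebra_simps)
    qed
    finally show ?thesis .
  qed
  ultimately show ?thesis by blast
qed

lemma holomorphic_halfplane_unique: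
  assumes "f holomorphic_on {s. Re s > c}" "g holomorphic_on {s. Re s > c}" "c \<le> 1"
    and "\<And>s. Re s > 1 \<Longrightarrow> f s = g s" and "Re z > c"
  shows "f z = g z"
proof (rule analytic_continuation_open[of "{s. Re s > 1}" "{s. Re s > c}" f g])
  show "{s. 1 < Re s} \<noteq> {}" by (auto intro: exI[of _ 2])
  show "connected {s. c < Re s}" by (intro convex_connected convex_halfspace_Re_gt)
qed (use assms in \<open>auto simp: open_halfspace_Re_gt\<close>)

theorem zeta_continuation_exists: "\<exists>F. is_zeta_continuation F"
proof -
  obtain h where h: "\<And>N. h N holomorphic_on {s. Re s > - real N}"
    "\<And>N s. Re s > 1 \<Longrightarrow> dirichlet_series (\<lambda>_. 1) s = 1 / (s - 1) + h N s"
    using zeta_continuation_halfplane by metis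
  have eq: "h M z = h N z" if "M \<le> N" "Re z > - real M" for M N z
  proof (rule holomorphic_halfplane_unique[where c = "- real M" and f = "h M" and g = "h N" and z = z])
    show "h N holomorphic_on {s. - real M < Re s}"
      using that by (intro holomorphic_on_subset[OF h(1)[of N]]) auto
    show "h M s = h N s" if "Re s > 1" for s
      using h(2)[OF that, of M] h(2)[OF that, of N] by simp
  qed (use h(1) that in auto)
  define K where "K z = nat \<lceil>\<bar>Re z\<bar> + 1\<rceil>" for z :: complex
  have K: "Re z > - real (K z)" for z unfolding K_def by linarith
  define H where "H z = h (K z) z" for z
  have HN: "H z = h N z" if "Re z > - real N" for z N
  proof (cases "K z \<le> N")
    case True
    thus ?thesis unfolding H_def by (intro eq K)
  next
    case False
    hence "h N z = h (K z) z" by (intro eq that) simp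
    thus ?thesis by (simp add: H_def)
  qed
  have "H holomorphic_on UNIV"
  proof -
    have "H holomorphic_on {s. Re s > - real N}" for N
      by (rule holomorphic_transform[OF h(1)[of N]]) (simp add: HN)
    hence "H holomorphic_on (\<Union>N. {s. Re s > - real N})"
      by (intro holomorphic_on_UN_open open_halfspace_Re_gt)
    moreover have "(\<Union>N. {s. Re s > - real N}) = UNIV" using K by blast
    ultimately show ?thesis by simp
  qed
  hence "(\<lambda>s. 1 / (s - 1) + H s) holomorphic_on (- {1})"
    by (intro holomorphic_intros) (auto intro: holomorphic_on_subset)
  moreover have "1 / (s - 1) + H s = dirichlet_series (\<lambda>_. 1) s" if "Re s > 1" for s
    using h(2)[OF that, of 0] HN[of 0 s] that by simp
  ultimately show ?thesis unfolding is_zeta_continuation_def by blast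
qed

theorem zeta_continuation_unique:
  assumes "is_zeta_continuation F" "is_zeta_continuation G" "s \<noteq> 1"
  shows "F s = G s"
proof (rule analytic_continuation_open[of "{s. Re s > 1}" "- {1}" F G])
  show "{s. 1 < Re s} \<noteq> {}" by (auto intro: exI[of _ 2])
  show "connected (- {1::complex})" by (intro connected_punctured_universe) auto
qed (use assms in \<open>auto simp: open_halfspace_Re_gt is_zeta_continuation_def\<close>)

lemma is_zeta_continuation_riemann_zeta: "is_zeta_continuation riemann_zeta"
  unfolding riemann_zeta_def using zeta_continuation_exists by (rule someI_ex)

end

theory Submission
  imports Defs "HOL-Probability.Probability" "HOL-Real_Asymp.Real_Asymp"
begin

text \<open>
  Write \<open>F\<close> for the Dirichlet series of \<open>f\<close>. For \<open>Re s > 1\<close>, unique factorization into a square and a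
  squarefree number gives \<open>F(s) \<zeta>(2s) \<Prod>\<^bsub>p | k\<^esub> (1 - g(p) p\<^bsup>-s\<^esup>) = L(s, \<chi>)\<close>. If \<open>M\<^sub>f(x) = o(x\<^sup>\<alpha>)\<close>, then \<open>F\<close> is
  holomorphic for \<open>Re s > \<alpha>\<close> and the identity extends, so a zero \<open>2s\<close> of \<open>\<zeta>\<close> with \<open>Re s > \<alpha>\<close> is a zero \<open>s\<close>
  of \<open>L\<close>. Then \<open>Re 2s = 1\<close>, where \<open>\<zeta>\<close> has no zeros.

  If \<open>\<alpha> < 1/4\<close>, then \<open>\<zeta>\<close> has no zeros to the right of \<open>2\<alpha> < 1/2\<close>. Without appeal to the functional
  equation this is impossible: a zero-free half plane makes \<open>\<zeta>(\<sigma> + it)\<close>, for fixed \<open>\<sigma>\<close> strictly between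
  \<open>2\<alpha>\<close> and \<open>1/2\<close>, smaller than every positive power of \<open>|t|\<close> (a normal family argument), whereas the
  mean square of \<open>(1 - 2\<^bsup>1-s\<^esup>) \<zeta>(s) = \<Sum> (-1)\<^bsup>n-1\<^esup> n\<^bsup>-s\<^esup>\<close> on \<open>Re s = \<sigma>\<close> grows like a positive power.
\<close>

section \<open>Dirichlet series with bounded partial sums\<close>

text \<open>The difference is \<open>s\<close> times an integral of the power \<open>-s - 1\<close>
  over a unit interval, read off from \<open>zint_by_parts\<close> with integrand 0 and primitive 1.
  The bound on \<open>zint\<close> is applied at \<open>s + 1\<close>, so real parts down to -1 are
  allowed.\<close>

lemma Suc_powr_diff_bound:
  obtains B :: real where "B \<ge> 0"
    "\<And>n s. Re s \<ge> -1 \<Longrightarrow> norm (of_nat (Suc n) powr (-s) - of_nat (Suc (Suc n)) powr (-s))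
         \<le> B * norm s * real (Suc n) powr (- Re s - 1)"
proof -
  obtain B where B: "B \<ge> 0"
    "\<And>n s. Re s \<ge> 0 \<Longrightarrow> norm (zint (\<lambda>_. 1) n s) \<le> B * real (Suc n) powr (- Re s)"
    using zint_bound[of "\<lambda>_. 1"] by auto
  have "norm (of_nat (Suc n) powr (-s) - of_nat (Suc (Suc n)) powr (-s))
         \<le> B * norm s * real (Suc n) powr (- Re s - 1)" if "Re s \<ge> -1" for n s
  proof -
    have "zint (\<lambda>_. 0) n s = 1 * node n 1 powr (-s) - 1 * node n 0 powr (-s) + s * zint (\<lambda>_. 1) n (s + 1)"
      by (rule zint_by_parts) auto
    hence "of_nat (Suc n) powr (-s) - of_nat (Suc (Suc n)) powr (-s) = s * zint (\<lambda>_. 1) n (s + 1)"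
      by (simp add: zint_def node_0 node_1 algebra_simps)
    moreover have "norm (s * zint (\<lambda>_. 1) n (s + 1)) \<le> norm s * (B * real (Suc n) powr (- Re (s + 1)))"
      unfolding norm_mult by (intro mult_left_mono B) (use that in auto)
    moreover have "- Re (s + 1) = - Re s - 1" by simp
    ultimately show ?thesis by (metis (no_types, lifting) mult.assoc mult.commute)
  qed
  thus ?thesis using B that by blast
qed

lemma partial_summation_Suc_powr:
  fixes a :: "nat \<Rightarrow> complex"
  shows "(\<Sum>n<N. a (Suc n) * of_nat (Suc n) powr (-s)) =
     (\<Sum>n<N. a (Suc n)) * of_nat (Suc N) powr (-s) +
     (\<Sum>n<N. (\<Sum>m<Suc n. a (Suc m)) * (of_nat (Suc n) powr (-s) - of_nat (Suc (Suc n)) powr (-s)))"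
proof (induction N)
  case (Suc N)
  show ?case
    unfolding sum.lessThan_Suc[of _ N] Suc.IH by (simp add: algebra_simps)
qed simp

text \<open>Partial summation turns the series into an absolutely convergent one. The error is
  \<open>1 + norm s\<close> times a null sequence independent of \<open>s\<close>, so one estimate
  serves both locally uniform convergence and integration along a whole vertical line.\<close>

lemma dirichlet_series_tail:
  fixes a :: "nat \<Rightarrow> complex"
  assumes A: "\<And>N. norm (\<Sum>n<N. a (Suc n)) \<le> C * real N powr \<alpha>" and "\<alpha> \<ge> 0" "\<sigma> > \<alpha>"
  obtains e where "e \<longlonglongrightarrow> 0"
    "\<And>s N. Re s \<ge> \<sigma> \<Longrightarrow> norm (dirichlet_series a s - (\<Sum>n<N. a (Suc n) * of_nat (Suc n) powr (-s)))
        \<le> (1 + norm s) * e N"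
proof -
  obtain B where B: "B \<ge> 0"
    "\<And>n s. Re s \<ge> -1 \<Longrightarrow> norm (of_nat (Suc n) powr (-s) - of_nat (Suc (Suc n)) powr (-s))
         \<le> B * norm s * real (Suc n) powr (- Re s - 1)"
    using Suc_powr_diff_bound by blast
  have C: "C \<ge> 0" using order_trans[OF norm_ge_zero A[of 1]] by simp
  \<comment> \<open>Growth \<alpha> of the partial sums against decay \<sigma> + 1 of the
    differences; summable because \<sigma> > \<alpha>.\<close>
  define h where "h n = real (Suc n) powr (- (1 + \<sigma> - \<alpha>))" for n
  have sumh: "summable h" unfolding h_def using assms by (intro summable_Suc_powr) auto
  \<comment> \<open>Tail of the summed series plus boundary term; they enter with weights
    \<open>norm s\<close> and 1, both at most \<open>1 + norm s\<close>.\<close>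
  define e where "e N = C * B * (\<Sum>n. h (n + N)) + C * real (Suc N) powr (- (\<sigma> - \<alpha>))" for N
  have e_nonneg: "e N \<ge> 0" for N
    unfolding e_def by (intro add_nonneg_nonneg mult_nonneg_nonneg C B suminf_nonneg
        summable_ignore_initial_segment sumh) (auto simp: h_def)
  have e0: "e \<longlonglongrightarrow> 0"
  proof -
    have "(\<lambda>N. \<Sum>n. h (n + N)) \<longlonglongrightarrow> 0"
    proof -
      have "(\<lambda>N. suminf h - sum h {..<N}) \<longlonglongrightarrow> suminf h - suminf h"
        by (intro tendsto_intros summable_LIMSEQ sumh)
      thus ?thesis by (simp add: suminf_minus_initial_segment[OF sumh])
    qed
    moreover have "(\<lambda>N. real (Suc N) powr (- (\<sigma> - \<alpha>))) \<longlonglongrightarrow> 0"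
      using assms
      by (intro tendsto_neg_powr filterlim_compose[OF filterlim_real_sequentially filterlim_Suc]) auto
    ultimately have "e \<longlonglongrightarrow> C * B * 0 + C * 0"
      unfolding e_def by (intro tendsto_add tendsto_mult tendsto_const)
    thus ?thesis by simp
  qed
  define t where "t s n = (\<Sum>m<Suc n. a (Suc m)) * (of_nat (Suc n) powr (-s) - of_nat (Suc (Suc n)) powr (-s))" for s n
  have t: "norm (t s n) \<le> C * B * norm s * h n" if s: "Re s \<ge> \<sigma>" for s n
  proof -
    have "norm (t s n) \<le> (C * real (Suc n) powr \<alpha>) * (B * norm s * real (Suc n) powr (- Re s - 1))"
      unfolding t_def norm_mult using s assms C B(1) by (intro mult_mono A B) auto
    also have "\<dots> = C * B * norm s * (real (Suc n) powr \<alpha> * real (Suc n) powr (- Re s - 1))"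
      by simp
    also have "real (Suc n) powr \<alpha> * real (Suc n) powr (- Re s - 1) \<le> h n"
      unfolding h_def powr_add[symmetric] using s by (intro powr_mono) auto
    finally show ?thesis using C B(1) by (simp add: mult_left_mono)
  qed
  have sumt: "summable (t s)" if s: "Re s \<ge> \<sigma>" for s
    by (rule summable_comparison_test'[OF summable_mult[OF sumh, of "C * B * norm s"], of 0]) (use t[OF s] in auto)
  define S where "S s N = (\<Sum>n<N. a (Suc n) * of_nat (Suc n) powr (-s))" for s N
  have main: "norm (suminf (t s) - S s N) \<le> (1 + norm s) * e N" if s: "Re s \<ge> \<sigma>" for s N
  proof -
    have "suminf (t s) - S s N = (\<Sum>n. t s (n + N)) - (\<Sum>n<N. a (Suc n)) * of_nat (Suc N) powr (-s)"
      unfolding S_def partial_summation_Suc_powr suminf_minus_initial_segment[OF sumt[OF s]]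
      by (simp add: t_def)
    also have "norm \<dots> \<le> norm (\<Sum>n. t s (n + N)) + norm ((\<Sum>n<N. a (Suc n)) * of_nat (Suc N) powr (-s))"
      by (rule norm_triangle_ineq4)
    also have "norm (\<Sum>n. t s (n + N)) \<le> (\<Sum>n. C * B * norm s * h (n + N))"
      by (rule norm_suminf_le[OF t[OF s]])
         (intro summable_mult summable_ignore_initial_segment sumh)
    also have "\<dots> = norm s * (C * B * (\<Sum>n. h (n + N)))"
      by (subst suminf_mult) (auto intro: summable_ignore_initial_segment sumh)
    also have "norm ((\<Sum>n<N. a (Suc n)) * of_nat (Suc N) powr (-s))
        \<le> (C * real (Suc N) powr \<alpha>) * real (Suc N) powr (- \<sigma>)"
    proof -
      have "norm (of_nat (Suc N) powr (-s) :: complex) = real (Suc N) powr (- Re s)"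
        by (subst norm_powr_real_powr) auto
      also have "\<dots> \<le> real (Suc N) powr (- \<sigma>)" using s by (intro powr_mono) auto
      finally have 1: "norm (of_nat (Suc N) powr (-s) :: complex) \<le> real (Suc N) powr (- \<sigma>)" .
      have "norm (\<Sum>n<N. a (Suc n)) \<le> C * real N powr \<alpha>" by (rule A)
      also have "\<dots> \<le> C * real (Suc N) powr \<alpha>"
        using C assms by (intro mult_left_mono powr_mono2) auto
      finally show ?thesis using 1 C unfolding norm_mult by (intro mult_mono) auto
    qed
    also have "\<dots> = C * real (Suc N) powr (- (\<sigma> - \<alpha>))"
      by (simp add: powr_add[symmetric])
    also have "norm s * (C * B * (\<Sum>n. h (n + N))) + C * real (Suc N) powr (- (\<sigma> - \<alpha>)) \<le> (1 + norm s) * e N"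
    proof -
      have "(1 + norm s) * e N = norm s * (C * B * (\<Sum>n. h (n + N))) + C * real (Suc N) powr (- (\<sigma> - \<alpha>))
         + (C * B * (\<Sum>n. h (n + N)) + norm s * (C * real (Suc N) powr (- (\<sigma> - \<alpha>))))"
        by (simp add: e_def algebra_simps)
      moreover have "C * B * (\<Sum>n. h (n + N)) \<ge> 0"
        by (intro mult_nonneg_nonneg C B suminf_nonneg
        summable_ignore_initial_segment sumh) (auto simp: h_def)
      moreover have "norm s * (C * real (Suc N) powr (- (\<sigma> - \<alpha>))) \<ge> 0" using C by simp
      ultimately show ?thesis by linarith
    qed
    finally show ?thesis by simp
  qed
  have lim: "S s \<longlonglongrightarrow> suminf (t s)" if s: "Re s \<ge> \<sigma>" for s
  proof -
    have "(\<lambda>N. (1 + norm s) * e N) \<longlonglongrightarrow> 0" using tendsto_mult_right_zero[OF e0] .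
    hence "(\<lambda>N. suminf (t s) - S s N) \<longlonglongrightarrow> 0"
      by (rule Lim_null_comparison[rotated]) (use main[OF s] in auto)
    from tendsto_diff[OF tendsto_const[of "suminf (t s)"] this] show ?thesis by simp
  qed
  have sums: "(\<lambda>n. a (Suc n) * of_nat (Suc n) powr (-s)) sums suminf (t s)" if s: "Re s \<ge> \<sigma>" for s
    using lim[OF s] unfolding sums_def S_def .
  hence eq: "dirichlet_series a s = suminf (t s)" if s: "Re s \<ge> \<sigma>" for s
    using that unfolding dirichlet_series_def by (metis sums_unique)
  show ?thesis
    by (rule that[OF e0]) (use main eq S_def in auto)
qed

lemma dirichlet_series_holomorphic:
  fixes a :: "nat \<Rightarrow> complex"
  assumes A: "\<And>N. norm (\<Sum>n<N. a (Suc n)) \<le> C * real N powr \<alpha>" "\<alpha> \<ge> 0"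
  shows "dirichlet_series a holomorphic_on {s. Re s > \<alpha>}"
proof (rule holomorphic_uniform_sequence)
  show "open {s. Re s > \<alpha>}" by (rule open_halfspace_Re_gt)
  show "(\<lambda>s. \<Sum>n<N. a (Suc n) * of_nat (Suc n) powr (-s)) holomorphic_on {s. Re s > \<alpha>}" for N
    by (intro holomorphic_intros) (auto simp del: of_nat_Suc)
next
  fix z assume "z \<in> {s. Re s > \<alpha>}"
  hence z: "Re z > \<alpha>" by simp
  define d where "d = (Re z - \<alpha>) / 2"
  have d: "d > 0" using z by (simp add: d_def)
  have Re: "Re s \<ge> \<alpha> + d" if "s \<in> cball z d" for s
    using abs_Re_le_cmod[of "z - s"] that by (auto simp: dist_norm d_def field_simps)
  obtain e where e: "e \<longlonglongrightarrow> 0"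
    "\<And>s N. Re s \<ge> \<alpha> + d \<Longrightarrow> norm (dirichlet_series a s - (\<Sum>n<N. a (Suc n) * of_nat (Suc n) powr (-s)))
        \<le> (1 + norm s) * e N"
    by (rule dirichlet_series_tail[OF A, of "\<alpha> + d"]) (use d in auto)
  have "uniform_limit (cball z d) (\<lambda>N s. \<Sum>n<N. a (Suc n) * of_nat (Suc n) powr (-s)) (dirichlet_series a) sequentially"
  proof (rule uniform_limitI)
    fix r :: real assume r: "r > 0"
    define K where "K = 1 + norm z + d"
    have "(\<lambda>N. K * e N) \<longlonglongrightarrow> 0" using tendsto_mult_right_zero[OF e(1)] .
    hence "\<forall>\<^sub>F N in sequentially. K * e N < r" using r by (rule order_tendstoD)
    thus "\<forall>\<^sub>F N in sequentially. \<forall>s\<in>cball z d.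
       dist (\<Sum>n<N. a (Suc n) * of_nat (Suc n) powr (-s)) (dirichlet_series a s) < r"
    proof eventually_elim
      case (elim N)
      show ?case
      proof
        fix s assume s: "s \<in> cball z d"
        have ns: "1 + norm s \<le> K"
          using s norm_triangle_ineq2[of s z] by (auto simp: K_def dist_norm norm_minus_commute)
        have *: "norm (dirichlet_series a s - (\<Sum>n<N. a (Suc n) * of_nat (Suc n) powr (-s))) \<le> (1 + norm s) * e N"
          by (rule e(2)[OF Re[OF s]])
        \<comment> \<open>The tail estimate asserts no sign for \<open>e N\<close>; it is recovered
          from the norm on the left.\<close>
        have "0 \<le> (1 + norm s) * e N" using order_trans[OF norm_ge_zero *] .
        hence "e N \<ge> 0" by (metis add_pos_nonneg less_numeral_extra(1) norm_ge_zero zero_le_mult_iff not_less)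
        hence "(1 + norm s) * e N \<le> K * e N" using ns by (intro mult_right_mono)
        thus "dist (\<Sum>n<N. a (Suc n) * of_nat (Suc n) powr (-s)) (dirichlet_series a s) < r"
          using * elim by (simp add: dist_norm norm_minus_commute)
      qed
    qed
  qed
  moreover have "cball z d \<subseteq> {s. Re s > \<alpha>}" using Re d by fastforce
  ultimately show "\<exists>d. 0 < d \<and> cball z d \<subseteq> {s. Re s > \<alpha>} \<and>
      uniform_limit (cball z d) (\<lambda>N s. \<Sum>n<N. a (Suc n) * of_nat (Suc n) powr (-s)) (dirichlet_series a) sequentially"
    using d by blast
qed

section \<open>The zeta function for Re s > 0: an explicit formula and linear growth\<close>

lemma riemann_zeta_holomorphic: "riemann_zeta holomorphic_on (- {1})"
  and riemann_zeta_eq_series: "Re s > 1 \<Longrightarrow> riemann_zeta s = dirichlet_series (\<lambda>_. 1) s"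
  using is_zeta_continuation_riemann_zeta by (auto simp: is_zeta_continuation_def)

text \<open>For Re s > 1 this is one integration by parts with primitive x - 1, which is -1 at 0 and
  0 at 1; the identity theorem does the rest. The sum converges for Re s > 0 because
  \<open>zint\<close> is evaluated at \<open>s + 1\<close>.\<close>

lemma riemann_zeta_eq_zint:
  assumes "Re s > 0" "s \<noteq> 1"
  shows "riemann_zeta s = 1 / (s - 1) - s * (\<Sum>n. zint (\<lambda>x. of_real x - 1) n (s + 1))"
proof (rule analytic_continuation_open[of "{s. Re s > 1}" "{s. Re s > 0} - {1}" riemann_zeta
      "\<lambda>s. 1 / (s - 1) - s * (\<Sum>n. zint (\<lambda>x. of_real x - 1) n (s + 1))"])
  let ?P = "\<lambda>x. complex_of_real x - 1"
  have contP: "continuous_on {0..1} ?P" by (intro continuous_intros)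
  show "open ({s. Re s > 0} - {1})"
    by (intro open_Diff open_halfspace_Re_gt) auto
  show "connected ({s. Re s > 0} - {1})"
    by (intro connected_open_delete open_halfspace_Re_gt convex_connected convex_halfspace_Re_gt) auto
  show "{s. 1 < Re s} \<noteq> {}" by (auto intro: exI[of _ 2])
  show "riemann_zeta holomorphic_on ({s. Re s > 0} - {1})"
    by (rule holomorphic_on_subset[OF riemann_zeta_holomorphic]) auto
  have "((\<lambda>s. \<Sum>n. zint ?P n s) \<circ> (\<lambda>s. s + 1)) holomorphic_on ({s. Re s > 0} - {1})"
    by (intro holomorphic_on_compose_gen[OF _ zint_suminf_holomorphic[OF contP]] holomorphic_intros) auto
  thus "(\<lambda>s. 1 / (s - 1) - s * (\<Sum>n. zint ?P n (s + 1))) holomorphic_on ({s. Re s > 0} - {1})"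
    by (intro holomorphic_intros) (auto simp: o_def)
  show "riemann_zeta s = 1 / (s - 1) - s * (\<Sum>n. zint ?P n (s + 1))" if "s \<in> {s. Re s > 1}" for s
  proof -
    have s: "Re s > 1" using that by simp
    have P': "(?P has_vector_derivative 1) (at x within {0..1})" for x
      by (auto intro!: derivative_eq_intros simp: has_vector_derivative_of_real)
    have "1 * of_nat (Suc n) powr (-s) = zint (\<lambda>_. 1) n s - s * zint ?P n (s + 1)" for n
      using zint_by_parts[OF _ P', of n s] by (simp add: node_0)
    hence "dirichlet_series (\<lambda>_. 1) s = (\<Sum>n. zint (\<lambda>_. 1) n s - s * zint ?P n (s + 1))"
      by (simp add: dirichlet_series_def)
    also have "\<dots> = 1 / (s - 1) - s * (\<Sum>n. zint ?P n (s + 1))"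
      using s by (intro sums_unique[symmetric] sums_diff sums_mult zint_one_sums summable_sums
          zint_summable contP) auto
    finally show ?thesis using s riemann_zeta_eq_series by simp
  qed
qed (use assms in \<open>auto simp: open_halfspace_Re_gt\<close>)

text \<open>The sum in \<open>riemann_zeta_eq_zint\<close> is bounded uniformly for Re s \<ge>
  \<delta>. Linear growth is enough later, where only log |zeta| = O(log |t|) from above
  matters.\<close>

lemma riemann_zeta_bound:
  assumes "\<delta> > 0"
  obtains C where "C \<ge> 1" "\<And>s. Re s \<ge> \<delta> \<Longrightarrow> norm (s - 1) \<ge> 1 \<Longrightarrow> norm (riemann_zeta s) \<le> C * (1 + norm s)"
proof -
  let ?P = "\<lambda>x. complex_of_real x - 1"
  have contP: "continuous_on {0..1} ?P" by (intro continuous_intros)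
  obtain B where B: "B \<ge> 0" "\<And>n s. Re s \<ge> 0 \<Longrightarrow> norm (zint ?P n s) \<le> B * real (Suc n) powr (- Re s)"
    using zint_bound[OF contP] by blast
  define K where "K = (\<Sum>n. B * real (Suc n) powr (- (1 + \<delta>)))"
  have sm: "summable (\<lambda>n. B * real (Suc n) powr (- (1 + \<delta>)))"
    using assms by (intro summable_mult summable_Suc_powr) auto
  have K: "K \<ge> 0" unfolding K_def by (intro suminf_nonneg sm mult_nonneg_nonneg B) auto
  have "norm (riemann_zeta s) \<le> (1 + K) * (1 + norm s)" if s: "Re s \<ge> \<delta>" "norm (s - 1) \<ge> 1" for s
  proof -
    have "norm (zint ?P n (s + 1)) \<le> B * real (Suc n) powr (- (1 + \<delta>))" for n
    proof -
      have "norm (zint ?P n (s + 1)) \<le> B * real (Suc n) powr (- Re (s + 1))"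
        by (rule B) (use s assms in auto)
      also have "\<dots> \<le> B * real (Suc n) powr (- (1 + \<delta>))"
        using s by (intro mult_left_mono powr_mono B) auto
      finally show ?thesis .
    qed
    hence n: "norm (\<Sum>n. zint ?P n (s + 1)) \<le> K" unfolding K_def using sm by (rule norm_suminf_le)
    have "norm (riemann_zeta s) \<le> norm (1 / (s - 1)) + norm (s * (\<Sum>n. zint ?P n (s + 1)))"
      using s assms by (subst riemann_zeta_eq_zint) (auto intro: norm_triangle_ineq4)
    also have "\<dots> \<le> 1 + norm s * K"
      unfolding norm_mult using s n by (intro add_mono mult_left_mono) (auto simp: norm_divide divide_le_eq_1)
    also have "\<dots> \<le> (1 + K) * (1 + norm s)" using K by (simp add: algebra_simps)
    finally show ?thesis .
  qed
  thus ?thesis using K that[of "1 + K"] by auto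
qed


section \<open>Euler products and the line \<open>Re s = 1\<close>\<close>

lemma of_nat_powr_mult:
  "m > 0 \<Longrightarrow> n > 0 \<Longrightarrow> (of_nat (m * n) :: complex) powr s = of_nat m powr s * of_nat n powr s"
  using powr_times_real[of "of_nat m" "of_nat n" s] by simp

text \<open>Passes from the ordered series to an unordered sum over the positive integers, the form
  in which terms can be regrouped by divisibility.\<close>

lemma dirichlet_series_has_sum:
  fixes a :: "nat \<Rightarrow> complex"
  assumes "\<And>n. n > 0 \<Longrightarrow> norm (a n) \<le> 1" "Re s > 1"
  shows "((\<lambda>n. a n * of_nat n powr (-s)) has_sum dirichlet_series a s) {0<..}"
proof -
  let ?f = "\<lambda>n. a (Suc n) * of_nat (Suc n) powr (-s)"
  have "summable (\<lambda>n. norm (?f n))"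
  proof (rule summable_comparison_test'[OF summable_Suc_powr[OF assms(2)], of 0])
    fix n
    have "norm (?f n) \<le> 1 * real (Suc n) powr (- Re s)"
      unfolding norm_mult by (intro mult_mono assms(1)) (auto simp: norm_powr_real_powr simp del: of_nat_Suc)
    thus "norm (norm (?f n)) \<le> real (Suc n) powr (- Re s)" by simp
  qed
  moreover from this have "?f sums dirichlet_series a s"
    unfolding dirichlet_series_def by (rule summable_norm_cancel[THEN summable_sums])
  ultimately have "(?f has_sum dirichlet_series a s) UNIV"
    by (rule norm_summable_imp_has_sum)
  moreover have "?f = (\<lambda>n. a n * of_nat n powr (-s)) \<circ> Suc" by (simp add: fun_eq_iff)
  ultimately show ?thesis
    unfolding greaterThan_0 by (subst has_sum_reindex) auto
qed

text \<open>Primes are removed one at a time. Among the integers without prime factor in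
  \<open>P\<close>, the multiples of a further prime p are exactly p times the same set, and so
  carry the share \<open>b p\<close> of the sum.\<close>

lemma euler_sieve:
  fixes b :: "nat \<Rightarrow> complex"
  assumes mult: "\<And>m n. m > 0 \<Longrightarrow> n > 0 \<Longrightarrow> b (m * n) = b m * b n"
    and b: "b summable_on {0<..}" and P: "finite P" "\<And>p. p \<in> P \<Longrightarrow> prime p"
  shows "infsum b {0<..} * (\<Prod>p\<in>P. 1 - b p) = infsum b {n. n > 0 \<and> (\<forall>p\<in>P. \<not> p dvd n)}"
  using P
proof (induction P)
  case empty
  thus ?case by (simp add: greaterThan_def)
next
  case (insert p P)
  define A where "A = {n::nat. n > 0 \<and> (\<forall>p\<in>P. \<not> p dvd n)}"
  have p: "prime p" "p > 0" using insert.prems by (auto intro: prime_gt_0_nat)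
  have P: "prime q" if "q \<in> P" for q using insert.prems that by auto
  have ndvd: "\<not> q dvd p" if "q \<in> P" for q
    using primes_dvd_imp_eq[OF P[OF that] p(1)] insert.hyps that by blast
  have sub: "(*) p ` A \<subseteq> A"
    using ndvd p P by (auto simp: A_def prime_dvd_mult_iff)
  have A: "b summable_on A" by (rule summable_on_subset_banach[OF b]) (auto simp: A_def)
  have pA: "b summable_on (*) p ` A" by (rule summable_on_subset_banach[OF A sub])
  have "{n. n > 0 \<and> (\<forall>p\<in>insert p P. \<not> p dvd n)} = A - (*) p ` A"
  proof (rule equalityI; rule subsetI)
    fix n assume "n \<in> A - (*) p ` A"
    moreover from this have "\<not> p dvd n" by (fastforce simp: A_def elim!: dvdE)
    ultimately show "n \<in> {n. n > 0 \<and> (\<forall>p\<in>insert p P. \<not> p dvd n)}" by (auto simp: A_def)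
  qed (auto simp: A_def)
  hence "infsum b {n. n > 0 \<and> (\<forall>p\<in>insert p P. \<not> p dvd n)} = infsum b A - infsum b ((*) p ` A)"
    using infsum_Diff[OF A pA sub] by simp
  also have "infsum b ((*) p ` A) = infsum (\<lambda>n. b p * b n) A"
    using p by (subst infsum_reindex) (auto intro!: inj_onI infsum_cong mult simp: A_def)
  also have "\<dots> = b p * infsum b A" by (rule infsum_cmult_right')
  also have "infsum b A - b p * infsum b A = infsum b A * (1 - b p)" by (simp add: algebra_simps)
  also have "infsum b A = infsum b {0<..} * (\<Prod>p\<in>P. 1 - b p)"
    using insert.IH insert.prems by (simp add: A_def)
  finally show ?case using insert.hyps by (simp add: mult_ac)
qed

text \<open>Sieving by all primes up to N leaves 1 and integers greater than N, whose sum is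
  dominated by a tail of an absolutely convergent series.\<close>

lemma euler_product_tendsto:
  fixes b :: "nat \<Rightarrow> complex"
  assumes mult: "\<And>m n. m > 0 \<Longrightarrow> n > 0 \<Longrightarrow> b (m * n) = b m * b n"
    and b: "b summable_on {0<..}" and "b 1 = 1"
  shows "(\<lambda>N. infsum b {0<..} * (\<Prod>p | prime p \<and> p \<le> N. 1 - b p)) \<longlonglongrightarrow> 1"
proof -
  define A where "A N = {n::nat. n > 0 \<and> (\<forall>p\<in>{p. prime p \<and> p \<le> N}. \<not> p dvd n)}" for N
  have A: "infsum b {0<..} * (\<Prod>p | prime p \<and> p \<le> N. 1 - b p) = infsum b (A N)" for N
    unfolding A_def by (rule euler_sieve[OF mult b]) auto
  have absb: "(\<lambda>n. norm (b n)) summable_on {0<..}"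
    using b unfolding summable_on_iff_abs_summable_on_complex .
  define h where "h n = norm (b (Suc n))" for n
  have h: "(h has_sum infsum (\<lambda>n. norm (b n)) {0<..}) UNIV"
    using has_sum_infsum[OF absb] unfolding greaterThan_0
    by (subst (asm) has_sum_reindex) (auto simp: h_def[abs_def] o_def)
  hence h': "h sums infsum (\<lambda>n. norm (b n)) {0<..}" by (rule has_sum_imp_sums)
  have "norm (infsum b (A N) - 1) \<le> infsum (\<lambda>n. norm (b n)) {0<..} - (\<Sum>n<N. h n)" for N
  proof -
    have one: "1 \<in> A N" by (auto simp: A_def)
    have sA: "b summable_on A N" by (rule summable_on_subset_banach[OF b]) (auto simp: A_def)
    have sA': "(\<lambda>n. norm (b n)) summable_on (A N - {1})"
      by (rule summable_on_subset_banach[OF absb]) (auto simp: A_def)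
    \<comment> \<open>An element other than 1 has a prime factor, which must exceed N.\<close>
    have sub: "A N - {1} \<subseteq> {0<..} - Suc ` {..<N}"
    proof
      fix n assume n: "n \<in> A N - {1}"
      hence "n > 1" by (auto simp: A_def)
      then obtain p where p: "prime p" "p dvd n" using prime_factor_nat[of n] by auto
      hence "p > N" using n by (auto simp: A_def)
      moreover have "p \<le> n" using p \<open>n > 1\<close> by (intro dvd_imp_le) auto
      ultimately show "n \<in> {0<..} - Suc ` {..<N}" by auto
    qed
    have "infsum b (A N) - 1 = infsum b (A N - {1})"
      using infsum_Diff[OF sA, of "{1}"] one \<open>b 1 = 1\<close> by auto
    also have "norm \<dots> \<le> infsum (\<lambda>n. norm (b n)) (A N - {1})"
      by (rule norm_infsum_bound[OF sA'])
    also have "\<dots> \<le> infsum (\<lambda>n. norm (b n)) ({0<..} - Suc ` {..<N})"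
      by (rule infsum_mono_neutral[OF sA' summable_on_subset_banach[OF absb]]) (use sub in auto)
    also have "\<dots> = infsum (\<lambda>n. norm (b n)) {0<..} - infsum (\<lambda>n. norm (b n)) (Suc ` {..<N})"
      by (rule infsum_Diff[OF absb]) auto
    also have "infsum (\<lambda>n. norm (b n)) (Suc ` {..<N}) = (\<Sum>n<N. h n)"
      by (simp add: sum.reindex h_def)
    finally show ?thesis .
  qed
  moreover have "(\<lambda>N. infsum (\<lambda>n. norm (b n)) {0<..} - (\<Sum>n<N. h n)) \<longlonglongrightarrow> 0"
    using tendsto_diff[OF tendsto_const h'[unfolded sums_def], of "infsum (\<lambda>n. norm (b n)) {0<..}"] by simp
  ultimately have "(\<lambda>N. infsum b (A N) - 1) \<longlonglongrightarrow> 0"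
    by (intro Lim_null_comparison[where f = "\<lambda>N. infsum b (A N) - 1"]) auto
  thus ?thesis unfolding A by (simp add: LIM_zero_iff)
qed

section \<open>The 3-4-1 inequality and non-vanishing on Re s = 1\<close>

text \<open>With z^n = e^(i \<theta>), the n-th terms of the logarithms combine to -(r^n / n) (3 + 4
  cos \<theta> + cos 2\<theta>) = -(2 r^n / n) (1 + cos \<theta>)^2. The factors are reciprocals of
  Euler factors, hence a bound from above.\<close>

lemma euler_factor_le_1:
  fixes r :: real and z :: complex
  assumes r: "0 < r" "r < 1" and z: "norm z = 1"
  shows "norm ((1 - of_real r) ^ 3 * (1 - of_real r * z) ^ 4 * (1 - of_real r * z ^ 2)) \<le> 1"
proof -
  \<comment> \<open>The term for n = 0 is 0, since division by 0 gives 0.\<close>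
  have ln: "(\<lambda>n. - Re (w ^ n) / n) sums ln (norm (1 - w))" if "norm w < 1" for w :: complex
  proof -
    have "(\<lambda>n. - ((-(-w)) ^ n) / of_nat n) sums ln (1 + (-w))"
      by (rule Ln_series') (use that in auto)
    from sums_Re[OF this] have "(\<lambda>n. - Re (w ^ n) / n) sums Re (ln (1 - w))"
      by simp
    moreover have "w \<noteq> 1" using that by auto
    ultimately show ?thesis by (simp add: Re_Ln)
  qed
  have nr: "norm (complex_of_real r * z) < 1" "norm (complex_of_real r * z ^ 2) < 1"
      "norm (complex_of_real r) < 1"
    using r z by (auto simp: norm_mult norm_power)
  have "(\<lambda>n. 3 * (- Re (of_real r ^ n) / n) + 4 * (- Re ((of_real r * z) ^ n) / n) + - Re ((of_real r * z ^ 2) ^ n) / n)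
    sums (3 * ln (norm (1 - complex_of_real r)) + 4 * ln (norm (1 - of_real r * z)) + ln (norm (1 - of_real r * z ^ 2)))"
    by (intro sums_add sums_mult ln nr)
  moreover have "3 * (- Re (of_real r ^ n) / n) + 4 * (- Re ((of_real r * z) ^ n) / n) + - Re ((of_real r * z ^ 2) ^ n) / n \<le> 0" for n
  proof -
    define u where "u = z ^ n"
    have "(Re u)\<^sup>2 + (Im u)\<^sup>2 = 1"
      using z by (simp add: u_def norm_power flip: cmod_power2)
    hence u2: "Re (u ^ 2) = 2 * (Re u) ^ 2 - 1" by (simp add: Re_power2)
    have 1: "Re (of_real r ^ n) = r ^ n" by (simp flip: of_real_power)
    have 2: "Re ((of_real r * z) ^ n) = r ^ n * Re u"
      by (simp add: power_mult_distrib u_def flip: of_real_power)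
    have 3: "Re ((of_real r * z ^ 2) ^ n) = r ^ n * Re (u ^ 2)"
      by (simp add: power_mult_distrib u_def mult.commute flip: of_real_power power_mult)
    have "3 * (- Re (of_real r ^ n) / n) + 4 * (- Re ((of_real r * z) ^ n) / n) + - Re ((of_real r * z ^ 2) ^ n) / n
      = - (r ^ n / n) * (2 * (1 + Re u) ^ 2)"
      unfolding 1 2 3 u2 by (cases "n = 0") (auto simp: field_simps power2_eq_square)
    also have "\<dots> \<le> 0" using r by (simp add: mult_nonneg_nonneg)
    finally show ?thesis .
  qed
  ultimately have le: "3 * ln (norm (1 - complex_of_real r)) + 4 * ln (norm (1 - of_real r * z)) + ln (norm (1 - of_real r * z ^ 2)) \<le> 0"
    by (rule sums_le[OF _ _ sums_zero, rotated])
  have nz: "1 - w \<noteq> 0" if "norm w < 1" for w :: complex using that by auto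
  have "ln (norm ((1 - complex_of_real r) ^ 3 * (1 - of_real r * z) ^ 4 * (1 - of_real r * z ^ 2))) \<le> 0"
    using le nz[OF nr(1)] nz[OF nr(2)] nz[OF nr(3)]
    by (simp add: norm_mult norm_power ln_mult ln_realpow)
  thus ?thesis using nz[OF nr(1)] nz[OF nr(2)] nz[OF nr(3)] by (subst (asm) ln_le_zero_iff) auto
qed

text \<open>The product of zeta values times the matching finite products of
  \<open>1 - b y p\<close> tends to 1, and those finite products together have norm at most
  1.\<close>

lemma riemann_zeta_3_4_1:
  fixes x t :: real
  assumes "x > 1"
  shows "norm (riemann_zeta x ^ 3 * riemann_zeta (Complex x t) ^ 4 * riemann_zeta (Complex x (2 * t))) \<ge> 1"
proof -
  define b where "b y n = of_nat n powr (- Complex x y)" for y and n :: nat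
  define Q where "Q y N = (\<Prod>p | prime p \<and> p \<le> N. 1 - b y p)" for y and N :: nat
  have b: "(b y has_sum riemann_zeta (Complex x y)) {0<..}" for y
    using dirichlet_series_has_sum[of "\<lambda>_. 1" "Complex x y"] assms
    by (simp add: riemann_zeta_eq_series b_def[abs_def])
  have lim: "(\<lambda>N. riemann_zeta (Complex x y) * Q y N) \<longlonglongrightarrow> 1" for y
    unfolding Q_def infsumI[OF b[of y], symmetric]
    by (rule euler_product_tendsto) (use b[of y] in \<open>auto simp: b_def of_nat_powr_mult summable_on_def simp del: of_nat_mult\<close>)
  have Q: "norm (Q 0 N ^ 3 * Q t N ^ 4 * Q (2 * t) N) \<le> 1" for N
  proof -
    have "norm (Q 0 N ^ 3 * Q t N ^ 4 * Q (2 * t) N) =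
      (\<Prod>p | prime p \<and> p \<le> N. norm ((1 - b 0 p) ^ 3 * (1 - b t p) ^ 4 * (1 - b (2 * t) p)))"
      by (simp add: Q_def prod.distrib prod_power_distrib prod_norm flip: norm_mult norm_power)
    also have "\<dots> \<le> 1"
    proof (rule prod_le_1, intro conjI)
      fix p :: nat assume p: "p \<in> {p. prime p \<and> p \<le> N}"
      hence p1: "p > 1" using prime_gt_1_nat by blast
      define r where "r = real p powr (-x)"
      define z where "z = complex_of_nat p powr (Complex 0 (- t))"
      have r: "0 < r" "r < 1" using p1 assms unfolding r_def by (auto intro: powr_less_one)
      have z: "norm z = 1" using p1 by (simp add: z_def norm_powr_real_powr)
      have rc: "complex_of_real r = of_nat p powr (Complex (-x) 0)"
        using p1 by (simp add: r_def powr_of_real[symmetric] complex_of_real_def[symmetric])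
      have c: "- Complex x y = Complex (- x) 0 + Complex 0 (- y)" for y
        by (simp add: complex_eq_iff)
      have "b 0 p = of_real r" unfolding rc b_def c
        by (rule arg_cong[where f = "\<lambda>w. _ powr w"]) (simp add: complex_eq_iff)
      moreover have "b t p = of_real r * z"
        unfolding rc b_def z_def powr_add[symmetric] c ..
      moreover have "b (2 * t) p = of_real r * z ^ 2"
        unfolding rc b_def z_def powr_add[symmetric] power2_eq_square c
        by (rule arg_cong[where f = "\<lambda>w. _ powr w"]) (simp add: complex_eq_iff)
      ultimately show "norm ((1 - b 0 p) ^ 3 * (1 - b t p) ^ 4 * (1 - b (2 * t) p)) \<le> 1"
        using euler_factor_le_1[OF r z] by simp
    qed auto
    finally show ?thesis .
  qed
  define R where "R = riemann_zeta (Complex x 0) ^ 3 * riemann_zeta (Complex x t) ^ 4 * riemann_zeta (Complex x (2 * t))"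
  have "(\<lambda>N. norm ((riemann_zeta (Complex x 0) * Q 0 N) ^ 3 * (riemann_zeta (Complex x t) * Q t N) ^ 4
          * (riemann_zeta (Complex x (2 * t)) * Q (2 * t) N))) \<longlonglongrightarrow> norm (1 ^ 3 * 1 ^ 4 * 1 :: complex)"
    by (intro tendsto_intros lim)
  moreover have "(riemann_zeta (Complex x 0) * Q 0 N) ^ 3 * (riemann_zeta (Complex x t) * Q t N) ^ 4
          * (riemann_zeta (Complex x (2 * t)) * Q (2 * t) N) = R * (Q 0 N ^ 3 * Q t N ^ 4 * Q (2 * t) N)" for N
    by (simp add: R_def power_mult_distrib mult_ac)
  ultimately have "(\<lambda>N. norm (R * (Q 0 N ^ 3 * Q t N ^ 4 * Q (2 * t) N))) \<longlonglongrightarrow> 1" by simp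
  moreover have "norm (R * (Q 0 N ^ 3 * Q t N ^ 4 * Q (2 * t) N)) \<le> norm R" for N
    using mult_left_mono[OF Q[of N] norm_ge_zero[of R]] by (simp add: norm_mult)
  ultimately have "1 \<le> norm R" by (intro LIMSEQ_le_const2) auto
  thus ?thesis by (simp add: R_def complex_of_real_def)
qed

text \<open>Clearing the denominator turns the pole at 1 into plain continuity for the limit taken
  below.\<close>

lemma riemann_zeta_times_pole_holomorphic:
  obtains H where "H holomorphic_on {s. Re s > 0}" "\<And>s. Re s > 0 \<Longrightarrow> s \<noteq> 1 \<Longrightarrow> H s = (s - 1) * riemann_zeta s"
proof
  let ?P = "\<lambda>x. complex_of_real x - 1"
  define H where "H s = 1 - (s - 1) * s * (\<Sum>n. zint ?P n (s + 1))" for s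
  have contP: "continuous_on {0..1} ?P" by (intro continuous_intros)
  have "((\<lambda>s. \<Sum>n. zint ?P n s) \<circ> (\<lambda>s. s + 1)) holomorphic_on {s. Re s > 0}"
    by (intro holomorphic_on_compose_gen[OF _ zint_suminf_holomorphic[OF contP]] holomorphic_intros) auto
  thus "H holomorphic_on {s. Re s > 0}"
    unfolding H_def by (intro holomorphic_intros) (auto simp: o_def)
  show "H s = (s - 1) * riemann_zeta s" if "Re s > 0" "s \<noteq> 1" for s
    using that by (simp add: riemann_zeta_eq_zint H_def algebra_simps)
qed

text \<open>At a zero 1 + it, the fourth power of zeta would outweigh the triple pole at 1, so the
  3-4-1 product at 1 + x would tend to 0 with x although it is at least 1.\<close>

lemma riemann_zeta_nonzero_Re_1:
  assumes "Re s = 1" "s \<noteq> 1"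
  shows "riemann_zeta s \<noteq> 0"
proof
  assume zero: "riemann_zeta s = 0"
  define t where "t = Im s"
  have s: "s = Complex 1 t" and t: "t \<noteq> 0" using assms by (auto simp: t_def complex_eq_iff)
  obtain H where H: "H holomorphic_on {s. Re s > 0}" "\<And>s. Re s > 0 \<Longrightarrow> s \<noteq> 1 \<Longrightarrow> H s = (s - 1) * riemann_zeta s"
    by (rule riemann_zeta_times_pole_holomorphic) blast
  define x where "x n = 1 / real (Suc n)" for n
  have x: "x n > 0" for n by (simp add: x_def)
  have x0: "x \<longlonglongrightarrow> 0" unfolding x_def by (rule LIMSEQ_Suc[OF lim_1_over_n])
  have cx0: "(\<lambda>n. w + complex_of_real (x n)) \<longlonglongrightarrow> w" for w
    using tendsto_add[OF tendsto_const tendsto_of_real[OF x0], of w] by simp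
  have isz: "isCont riemann_zeta w" if "w \<noteq> 1" for w
    using holomorphic_on_imp_continuous_on[OF riemann_zeta_holomorphic] that
    by (subst (asm) continuous_on_eq_continuous_at) auto
  have isH: "isCont H 1"
    using holomorphic_on_imp_continuous_on[OF H(1)]
    by (subst (asm) continuous_on_eq_continuous_at) (auto simp: open_halfspace_Re_gt)
  have 1: "(\<lambda>n. H (1 + of_real (x n))) \<longlonglongrightarrow> H 1"
    by (rule isCont_tendsto_compose[OF isH cx0])
  have 2: "(\<lambda>n. riemann_zeta (Complex 1 (2*t) + of_real (x n))) \<longlonglongrightarrow> riemann_zeta (Complex 1 (2*t))"
    by (rule isCont_tendsto_compose[OF isz cx0]) (use t in \<open>auto simp: complex_eq_iff\<close>)
  have "(riemann_zeta has_field_derivative deriv riemann_zeta s) (at s)"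
    by (rule holomorphic_derivI[OF riemann_zeta_holomorphic]) (use assms in auto)
  hence "((\<lambda>h. (riemann_zeta (s + h) - riemann_zeta s) / h) \<longlongrightarrow> deriv riemann_zeta s) (at 0)"
    by (simp add: DERIV_def)
  moreover have "filterlim (\<lambda>n. complex_of_real (x n)) (at 0) sequentially"
    using tendsto_of_real[OF x0, where 'a = complex] x
    by (auto simp: filterlim_at less_imp_neq[THEN not_sym])
  ultimately have 3: "(\<lambda>n. riemann_zeta (s + of_real (x n)) / of_real (x n)) \<longlonglongrightarrow> deriv riemann_zeta s"
    using zero by (auto dest: filterlim_compose simp: o_def)
  \<comment> \<open>\<open>H\<close> supplies three powers of \<open>x n\<close>, the difference
    quotients remove four, and the last factor restores the balance: this is the 3-4-1 product at
    \<open>1 + x n\<close>.\<close>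
  have "(\<lambda>n. norm (H (1 + of_real (x n)) ^ 3 * (riemann_zeta (s + of_real (x n)) / of_real (x n)) ^ 4
       * riemann_zeta (Complex 1 (2*t) + of_real (x n)) * of_real (x n)))
      \<longlonglongrightarrow> norm (H 1 ^ 3 * deriv riemann_zeta s ^ 4 * riemann_zeta (Complex 1 (2*t)) * of_real 0)"
    by (intro tendsto_intros 1 2 3 x0)
  moreover have "norm (H (1 + of_real (x n)) ^ 3 * (riemann_zeta (s + of_real (x n)) / of_real (x n)) ^ 4
       * riemann_zeta (Complex 1 (2*t) + of_real (x n)) * of_real (x n)) \<ge> 1" for n
  proof -
    have "H (1 + of_real (x n)) = of_real (x n) * riemann_zeta (of_real (1 + x n))"
      using x[of n] by (subst H) (auto simp: complex_eq_iff)
    moreover have "s + of_real (x n) = Complex (1 + x n) t" "Complex 1 (2*t) + of_real (x n) = Complex (1 + x n) (2 * t)"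
      by (auto simp: s complex_eq_iff)
    ultimately have "H (1 + of_real (x n)) ^ 3 * (riemann_zeta (s + of_real (x n)) / of_real (x n)) ^ 4
       * riemann_zeta (Complex 1 (2*t) + of_real (x n)) * of_real (x n) =
       riemann_zeta (of_real (1 + x n)) ^ 3 * riemann_zeta (Complex (1 + x n) t) ^ 4 * riemann_zeta (Complex (1 + x n) (2 * t))"
      using x[of n] by (simp add: field_simps power_numeral_reduce)
    thus ?thesis using riemann_zeta_3_4_1[of "1 + x n" t] x[of n] by simp
  qed
  ultimately have "norm (H 1 ^ 3 * deriv riemann_zeta s ^ 4 * riemann_zeta (Complex 1 (2*t)) * of_real 0) \<ge> 1"
    by (intro LIMSEQ_le_const) auto
  thus False by simp
qed


section \<open>The Dirichlet series of \<open>\<mu>\<^sup>2 g\<close>\<close>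

text \<open>The exponent of p in d^2 m is twice that in d plus 0 or 1, so halving recovers d. As 0
  is not squarefree, m is automatically positive.\<close>

lemma square_times_squarefree_bij:
  "bij_betw (\<lambda>(d, m). d\<^sup>2 * m) ({0<..} \<times> {m. squarefree m}) ({0<..} :: nat set)"
proof (rule bij_betw_byWitness[where f' = "\<lambda>n. (square_part n, squarefree_part n)"])
  show "\<forall>a\<in>{0<..} \<times> {m. squarefree m}.
     (\<lambda>n. (square_part n, squarefree_part n)) (case a of (d, m) \<Rightarrow> d\<^sup>2 * m) = (a :: nat \<times> nat)"
  proof
    fix a :: "nat \<times> nat" assume "a \<in> {0<..} \<times> {m. squarefree m}"
    then obtain d m where a: "a = (d, m)" and d: "d > 0" and m: "squarefree m" by auto
    have "m \<noteq> 0" using m by (metis not_squarefree_0)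
    have "square_part (d\<^sup>2 * m) = d"
    proof (rule multiplicity_eq_nat)
      fix p :: nat assume p: "prime p"
      have "multiplicity p m \<le> 1"
        using m p by (subst (asm) squarefree_factorial_semiring'') (auto simp: \<open>m \<noteq> 0\<close>)
      thus "multiplicity p (square_part (d\<^sup>2 * m)) = multiplicity p d"
        using p d \<open>m \<noteq> 0\<close> by (simp add: prime_multiplicity_square_part prime_elem_multiplicity_mult_distrib
            prime_elem_multiplicity_power_distrib)
    qed (use d \<open>m \<noteq> 0\<close> in \<open>auto intro!: Nat.gr0I\<close>)
    moreover from this have "squarefree_part (d\<^sup>2 * m) = m"
      using squarefree_decompose[of "d\<^sup>2 * m"] d by simp
    ultimately show "(\<lambda>n. (square_part n, squarefree_part n)) (case a of (d, m) \<Rightarrow> d\<^sup>2 * m) = a"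
      by (simp add: a)
  qed
  show "\<forall>n\<in>({0<..} :: nat set). (case (square_part n, squarefree_part n) of (d, m) \<Rightarrow> d\<^sup>2 * m) = n"
    using squarefree_decompose[where 'a = nat] by (auto simp: mult.commute)
qed (auto intro!: Nat.gr0I simp: not_squarefree_0)

context
  fixes g :: "nat \<Rightarrow> real"
  assumes cm: "completely_multiplicative g" and pm: "\<And>n. n > 0 \<Longrightarrow> g n \<in> {-1, 1}"
begin

lemma sign_norm_le_1: "n > 0 \<Longrightarrow> norm (complex_of_real (g n)) \<le> 1"
  using pm[of n] by auto

lemma sign_powr_mult:
  assumes "m > 0" "n > 0"
  shows "complex_of_real (g (m * n)) * of_nat (m * n) powr s =
         (complex_of_real (g m) * of_nat m powr s) * (of_real (g n) * of_nat n powr s)"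
  using cm assms by (simp add: completely_multiplicative_def of_nat_powr_mult del: of_nat_mult)

text \<open>Write n = d^2 m with m squarefree. Since \<open>g\<close> takes signs as values,
  \<open>g (d\<^sup>2) = 1\<close>, and absolute convergence splits the sum into zeta(2s), from d,
  times the sum over m.\<close>

lemma squarefree_dirichlet_series:
  assumes s: "Re s > 1"
  shows "dirichlet_series (\<lambda>n. of_real ((moebius_mu n)\<^sup>2 * g n)) s * riemann_zeta (2 * s)
       = dirichlet_series (\<lambda>n. of_real (g n)) s"
proof -
  define b where "b n = complex_of_real (g n) * of_nat n powr (-s)" for n
  let ?S = "{m::nat. squarefree m}"
  have b: "(b has_sum dirichlet_series (\<lambda>n. of_real (g n)) s) {0<..}"
    unfolding b_def by (rule dirichlet_series_has_sum[OF sign_norm_le_1 s])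
  have f: "infsum b ?S = dirichlet_series (\<lambda>n. of_real ((moebius_mu n)\<^sup>2 * g n)) s"
  proof -
    have "((\<lambda>n. complex_of_real ((moebius_mu n)\<^sup>2 * g n) * of_nat n powr (-s)) has_sum
       dirichlet_series (\<lambda>n. of_real ((moebius_mu n)\<^sup>2 * g n)) s) {0<..}"
      using sign_norm_le_1 by (intro dirichlet_series_has_sum s) (auto simp: moebius_mu_squared)
    from infsumI[OF this] show ?thesis
      by (subst infsum_cong_neutral[where g = "\<lambda>n. complex_of_real ((moebius_mu n)\<^sup>2 * g n) * of_nat n powr (-s)"
            and T = "{0<..}"]) (auto simp: moebius_mu_squared b_def intro!: Nat.gr0I)
  qed
  have z: "infsum (\<lambda>d. b (d\<^sup>2)) {0<..} = riemann_zeta (2 * s)"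
  proof -
    have "((\<lambda>n. 1 * of_nat n powr (-(2 * s))) has_sum dirichlet_series (\<lambda>_. 1) (2 * s)) {0<..}"
      by (intro dirichlet_series_has_sum) (use s in auto)
    hence "((\<lambda>n. of_nat n powr (-(2 * s))) has_sum riemann_zeta (2 * s)) {0<..}"
      using s by (simp add: riemann_zeta_eq_series)
    moreover have "b (d\<^sup>2) = of_nat d powr (-(2 * s))" if "d > 0" for d
    proof -
      have "g d * g d = 1" using pm[OF that] by auto
      hence "complex_of_real (g d) * of_real (g d) = 1" by (metis of_real_1 of_real_mult)
      hence "b (d\<^sup>2) = of_nat d powr (-s) * of_nat d powr (-s)"
        unfolding b_def power2_eq_square sign_powr_mult[OF that that] by (simp add: mult_ac)
      thus ?thesis by (simp add: powr_add[symmetric])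
    qed
    ultimately show ?thesis by (subst infsum_cong) (auto intro: infsumI)
  qed
  let ?h = "\<lambda>(d, m). d\<^sup>2 * m :: nat"
  have "(\<lambda>x. b (?h x)) summable_on ({0<..} \<times> ?S)"
    using b summable_on_reindex_bij_betw[OF square_times_squarefree_bij, of b]
    by (auto simp: summable_on_def)
  from infsum_Sigma_banach[OF this]
  have "infsum (\<lambda>x. b (?h x)) ({0<..} \<times> ?S) = infsum (\<lambda>d. infsum (\<lambda>m. b (d\<^sup>2 * m)) ?S) {0<..}"
    by simp
  also have "\<dots> = infsum (\<lambda>d. b (d\<^sup>2) * infsum b ?S) {0<..}"
  proof (rule infsum_cong)
    fix d :: nat assume d: "d \<in> {0<..}"
    have "infsum (\<lambda>m. b (d\<^sup>2 * m)) ?S = infsum (\<lambda>m. b (d\<^sup>2) * b m) ?S"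
      unfolding b_def by (intro infsum_cong sign_powr_mult) (use d in \<open>auto intro!: Nat.gr0I\<close>)
    thus "infsum (\<lambda>m. b (d\<^sup>2 * m)) ?S = b (d\<^sup>2) * infsum b ?S"
      by (simp add: infsum_cmult_right')
  qed
  also have "\<dots> = riemann_zeta (2 * s) * infsum b ?S"
    by (simp add: infsum_cmult_left' z)
  finally show ?thesis
    using infsum_reindex_bij_betw[OF square_times_squarefree_bij, of b] infsumI[OF b]
    by (simp add: f mult.commute)
qed

text \<open>Sieving by the primes dividing \<open>k\<close> leaves the integers coprime to
  \<open>k\<close>, where \<open>g\<close> and \<open>chi\<close> agree.\<close>

lemma sign_extension_dirichlet_series:
  assumes s: "Re s > 1" and "k > 0"
    and chi: "\<And>n. n > 0 \<Longrightarrow> chi n = (if coprime n k then of_real (g n) else 0)"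
  shows "dirichlet_series (\<lambda>n. of_real (g n)) s * (\<Prod>p | prime p \<and> p dvd k. 1 - of_real (g p) * of_nat p powr (-s))
       = dirichlet_L chi s"
proof -
  define b where "b n = complex_of_real (g n) * of_nat n powr (-s)" for n
  have b: "(b has_sum dirichlet_series (\<lambda>n. of_real (g n)) s) {0<..}"
    unfolding b_def by (rule dirichlet_series_has_sum[OF sign_norm_le_1 s])
  have "infsum b {0<..} * (\<Prod>p | prime p \<and> p dvd k. 1 - b p)
      = infsum b {n. n > 0 \<and> (\<forall>p\<in>{p. prime p \<and> p dvd k}. \<not> p dvd n)}"
    using b \<open>k > 0\<close> by (intro euler_sieve) (auto simp: b_def sign_powr_mult summable_on_def simp del: of_nat_mult)
  also have "{n. n > 0 \<and> (\<forall>p\<in>{p. prime p \<and> p dvd k}. \<not> p dvd n)} = {n. n > 0 \<and> coprime n k}"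
  proof -
    have "coprime n k \<longleftrightarrow> (\<forall>p\<in>{p. prime p \<and> p dvd k}. \<not> p dvd n)" for n
    proof
      assume "coprime n k"
      thus "\<forall>p\<in>{p. prime p \<and> p dvd k}. \<not> p dvd n"
        using coprime_common_divisor not_prime_unit by blast
    next
      assume *: "\<forall>p\<in>{p. prime p \<and> p dvd k}. \<not> p dvd n"
      show "coprime n k"
      proof (rule ccontr)
        assume "\<not> coprime n k"
        then obtain p where "prime p" "p dvd gcd n k"
          using prime_factor_nat[of "gcd n k"] by (metis coprime_iff_gcd_eq_1)
        thus False using * by auto
      qed
    qed
    thus ?thesis by simp
  qed
  also have "infsum b {n. n > 0 \<and> coprime n k} = infsum (\<lambda>n. chi n * of_nat n powr (-s)) {0<..}"
    by (rule infsum_cong_neutral) (auto simp: chi b_def)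
  also have "\<dots> = dirichlet_L chi s"
    unfolding dirichlet_L_def using sign_norm_le_1
    by (intro infsumI dirichlet_series_has_sum s) (auto simp: chi)
  finally show ?thesis unfolding infsumI[OF b] by (simp add: b_def)
qed

end

section \<open>Bounded character sums and the passage from L to zeta\<close>

text \<open>Multiplication by a unit m with \<open>chi m \<noteq> 1\<close> permutes the residues,
  so the sum is unchanged when multiplied by \<open>chi m\<close>.\<close>

lemma nonprincipal_character_sum:
  assumes chi: "dirichlet_character k chi" "chi \<noteq> principal_character k"
  shows "(\<Sum>n<k. chi n) = 0"
proof -
  have k: "k > 0" and per: "\<And>n. chi (n + k) = chi n" and mult: "\<And>m n. chi (m * n) = chi m * chi n"
    and nz: "\<And>n. chi n \<noteq> 0 \<longleftrightarrow> coprime n k"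
    using chi by (auto simp: dirichlet_character_def)
  obtain m where "chi m \<noteq> principal_character k m" using chi by auto
  \<comment> \<open>Off the units both characters vanish, so they can differ only at a unit.\<close>
  hence m: "coprime m k" "chi m \<noteq> 1" using nz[of m] by (auto simp: principal_character_def split: if_splits)
  have chi_mod: "chi (n mod k) = chi n" for n
  proof -
    have "chi (q * k + r) = chi r" for q r
    proof (induction q)
      case (Suc q)
      thus ?case using per[of "q * k + r"] by (simp add: ac_simps)
    qed simp
    from this[of "n div k" "n mod k"] show ?thesis by simp
  qed
  have inj: "inj_on (\<lambda>n. m * n mod k) {..<k}"
  proof (rule inj_onI)
    fix x y assume xy: "x \<in> {..<k}" "y \<in> {..<k}" "m * x mod k = m * y mod k"
    hence "[m * x = m * y] (mod k)" by (simp add: cong_def)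
    hence "[x = y] (mod k)" using m(1) by (simp add: cong_mult_lcancel_nat)
    thus "x = y" using xy by (simp add: cong_def)
  qed
  moreover have "(\<lambda>n. m * n mod k) ` {..<k} \<subseteq> {..<k}" using k by auto
  ultimately have im: "(\<lambda>n. m * n mod k) ` {..<k} = {..<k}" by (intro endo_inj_surj) auto
  have "chi m * (\<Sum>n<k. chi n) = (\<Sum>n<k. chi (m * n mod k))"
    by (simp add: sum_distrib_left chi_mod mult)
  also have "\<dots> = (\<Sum>n\<in>(\<lambda>n. m * n mod k) ` {..<k}. chi n)"
    by (simp add: sum.reindex[OF inj])
  finally have "(chi m - 1) * (\<Sum>n<k. chi n) = 0" unfolding im by (simp add: algebra_simps)
  thus ?thesis using m(2) by simp
qed

text \<open>Full periods cancel, leaving fewer than \<open>k\<close> terms and the index shift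
  \<open>chi 0\<close>. The factor \<open>real N powr 0\<close> matches the tail estimate with
  exponent 0; it is 0 at N = 0, like the empty sum, and 1 otherwise.\<close>

lemma nonprincipal_character_partial_sums:
  assumes chi: "dirichlet_character k chi" "chi \<noteq> principal_character k"
    and le: "\<And>n. norm (chi n) \<le> 1"
  shows "norm (\<Sum>n<N. chi (Suc n)) \<le> (real k + 1) * real N powr 0"
proof (cases "N = 0")
  case False
  have k: "k > 0" and per: "\<And>n. chi (n + k) = chi n"
    using chi by (auto simp: dirichlet_character_def)
  have step: "(\<Sum>n<N + k. chi n) = (\<Sum>n<N. chi n)" for N
    by (induction N) (auto simp: per nonprincipal_character_sum[OF chi])
  have "(\<Sum>n<q * k + r. chi n) = (\<Sum>n<r. chi n)" for q r
  proof (induction q)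
    case (Suc q)
    have "Suc q * k + r = (q * k + r) + k" by simp
    thus ?case using step[of "q * k + r"] Suc.IH by metis
  qed simp
  from this[of "Suc N div k" "Suc N mod k"]
  have "(\<Sum>n<Suc N. chi n) = (\<Sum>n<Suc N mod k. chi n)" by simp
  hence "(\<Sum>n<N. chi (Suc n)) = (\<Sum>n<Suc N mod k. chi n) - chi 0"
    by (simp add: sum.lessThan_Suc_shift eq_diff_eq add.commute del: sum.lessThan_Suc)
  also have "norm \<dots> \<le> norm (\<Sum>n<Suc N mod k. chi n) + norm (chi 0)" by (rule norm_triangle_ineq4)
  also have "norm (\<Sum>n<Suc N mod k. chi n) \<le> (\<Sum>n<Suc N mod k. 1)"
    by (intro sum_norm_le le)
  also have "\<dots> \<le> real k" using k mod_less_divisor[of k "Suc N"] by (simp add: less_imp_le)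
  finally show ?thesis using le[of 0] False by simp
qed simp

text \<open>The finitely many partial sums before the o-estimate takes effect are absorbed in the
  constant, as N^\<alpha> \<ge> 1 for N > 0.\<close>

lemma smallo_summatory_bound:
  assumes "\<alpha> > 0" "summatory f \<in> o[at_top](\<lambda>x. x powr \<alpha>)"
  obtains C where "\<And>N. norm (\<Sum>n<N. complex_of_real (f (Suc n))) \<le> C * real N powr \<alpha>"
proof -
  define A where "A N = (\<Sum>n<N. complex_of_real (f (Suc n)))" for N
  have A: "norm (A N) = norm (summatory f (real N))" for N
  proof -
    have "{n. 0 < n \<and> real n \<le> real N} = Suc ` {..<N}"
      by (auto simp: image_iff gr0_conv_Suc)
    hence "summatory f (real N) = (\<Sum>n<N. f (Suc n))"
      by (simp add: summatory_def sum.reindex)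
    thus ?thesis by (simp add: A_def flip: of_real_sum)
  qed
  have "eventually (\<lambda>x. norm (summatory f x) \<le> 1 * norm (x powr \<alpha>)) at_top"
    using assms(2) by (rule landau_o.smallD) simp
  hence "eventually (\<lambda>N. norm (summatory f (real N)) \<le> 1 * norm (real N powr \<alpha>)) sequentially"
    by (rule eventually_compose_filterlim[OF _ filterlim_real_sequentially])
  then obtain N0 where N0: "\<And>N. N \<ge> N0 \<Longrightarrow> norm (A N) \<le> real N powr \<alpha>"
    by (auto simp: eventually_sequentially A)
  define C where "C = 1 + (\<Sum>N<N0. norm (A N))"
  have C: "C \<ge> 1" unfolding C_def by (simp add: sum_nonneg)
  have "norm (A N) \<le> C * real N powr \<alpha>" for N
  proof (cases "N \<ge> N0 \<or> N = 0")
    case True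
    thus ?thesis using N0[of N] mult_right_mono[OF C, of "real N powr \<alpha>"] by (auto simp: A_def)
  next
    case False
    have "norm (A N) \<le> C * 1" unfolding C_def
      using False member_le_sum[of N "{..<N0}" "\<lambda>N. norm (A N)"] by auto
    also have "\<dots> \<le> C * real N powr \<alpha>"
      using C False assms(1) by (intro mult_left_mono ge_one_powr_ge_zero) auto
    finally show ?thesis .
  qed
  thus ?thesis using that unfolding A_def by blast
qed

text \<open>The identity F(w) zeta(2w) Q(w) = L(w, chi) is continued to Re w > \<alpha> without w =
  1/2, the pole of zeta(2w). A zero s of zeta annihilates the left side at w = s/2 whatever F and Q
  are there.\<close>

lemma riemann_zeta_zero_free:
  assumes chi: "dirichlet_character k chi" "chi \<noteq> principal_character k" "sign_extension k chi g"
    and f: "f = (\<lambda>n. (moebius_mu n)\<^sup>2 * g n)"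
    and L: "\<And>s. Re s > 0 \<Longrightarrow> dirichlet_L chi s = 0 \<Longrightarrow> Re s = 1 / 2"
    and \<alpha>: "\<alpha> > 0" "summatory f \<in> o[at_top](\<lambda>x. x powr \<alpha>)"
    and s: "Re s > 2 * \<alpha>" "s \<noteq> 1"
  shows "riemann_zeta s \<noteq> 0"
proof
  assume zero: "riemann_zeta s = 0"
  have cm: "completely_multiplicative g" and pm: "\<And>n. n > 0 \<Longrightarrow> g n \<in> {-1, 1}"
    and gchi: "\<And>n. n > 0 \<Longrightarrow> coprime n k \<Longrightarrow> of_real (g n) = chi n"
    using chi by (auto simp: sign_extension_def)
  have k: "k > 0" and per: "\<And>n. chi (n + k) = chi n" and nz: "\<And>n. chi n \<noteq> 0 \<longleftrightarrow> coprime n k"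
    using chi by (auto simp: dirichlet_character_def)
  have chi_eq: "chi n = (if coprime n k then of_real (g n) else 0)" if "n > 0" for n
    using gchi[OF that] nz[of n] by auto
  have "norm (chi n) \<le> 1" if "n > 0" for n
    using chi_eq[OF that] pm[OF that] by auto
  \<comment> \<open>Periodicity covers n = 0, since \<open>chi 0 = chi k\<close>.\<close>
  hence le: "norm (chi n) \<le> 1" for n
    using per[of n] k by (metis add_gr_0)
  define F where "F = dirichlet_series (\<lambda>n. of_real (f n))"
  define Q where "Q s = (\<Prod>p | prime p \<and> p dvd k. 1 - complex_of_real (g p) * of_nat p powr (-s))" for s
  obtain C where C: "\<And>N. norm (\<Sum>n<N. complex_of_real (f (Suc n))) \<le> C * real N powr \<alpha>"
    using smallo_summatory_bound[OF \<alpha>] by blast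
  have "F w * riemann_zeta (2 * w) * Q w = dirichlet_L chi w" if w: "Re w > \<alpha>" "w \<noteq> 1/2" for w
  proof (rule analytic_continuation_open[of "{s. Re s > max 1 \<alpha>}" "{s. Re s > \<alpha>} - {1/2}"
       "\<lambda>w. F w * riemann_zeta (2 * w) * Q w" "dirichlet_L chi"])
    show "open {s. Re s > max 1 \<alpha>}" by (rule open_halfspace_Re_gt)
    show "open ({s. Re s > \<alpha>} - {1/2})" by (intro open_Diff open_halfspace_Re_gt) auto
    show "connected ({s. Re s > \<alpha>} - {1/2})"
      by (intro connected_open_delete open_halfspace_Re_gt convex_connected convex_halfspace_Re_gt) auto
    show "{s. max 1 \<alpha> < Re s} \<noteq> {}" by (use \<alpha>(1) in \<open>auto intro!: exI[of _ "of_real (2 + \<alpha>)"]\<close>)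
    show "{s. max 1 \<alpha> < Re s} \<subseteq> {s. Re s > \<alpha>} - {1/2}" by auto
    have "F holomorphic_on {s. Re s > \<alpha>} - {1/2}"
      unfolding F_def using \<alpha> by (intro holomorphic_on_subset[OF dirichlet_series_holomorphic[OF C]]) auto
    moreover have "(riemann_zeta \<circ> (\<lambda>w. 2 * w)) holomorphic_on {s. Re s > \<alpha>} - {1/2}"
      by (intro holomorphic_on_compose_gen[OF _ riemann_zeta_holomorphic] holomorphic_intros)
         (auto simp: field_simps)
    moreover have "Q holomorphic_on {s. Re s > \<alpha>} - {1/2}"
      unfolding Q_def by (intro holomorphic_intros) (auto dest: prime_gt_0_nat)
    ultimately show "(\<lambda>w. F w * riemann_zeta (2 * w) * Q w) holomorphic_on {s. Re s > \<alpha>} - {1/2}"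
      by (intro holomorphic_intros) (auto simp: o_def)
    have "dirichlet_series chi holomorphic_on {s. Re s > 0}"
      by (rule dirichlet_series_holomorphic[OF nonprincipal_character_partial_sums[OF chi(1,2) le]]) auto
    thus "dirichlet_L chi holomorphic_on {s. Re s > \<alpha>} - {1/2}"
      unfolding dirichlet_L_def[abs_def] using \<alpha> by (auto elim!: holomorphic_on_subset)
    show "F w * riemann_zeta (2 * w) * Q w = dirichlet_L chi w" if "w \<in> {s. max 1 \<alpha> < Re s}" for w
      using squarefree_dirichlet_series[OF cm pm, of w] that
        sign_extension_dirichlet_series[OF cm pm _ k chi_eq, of w]
      by (simp add: F_def f Q_def)
  qed (use w in \<open>auto intro: open_halfspace_Re_gt\<close>)
  from this[of "s / 2"] have "dirichlet_L chi (s / 2) = 0" using s zero by auto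
  hence "Re (s / 2) = 1 / 2" using s \<alpha> by (intro L) auto
  hence "Re s = 1" by simp
  from riemann_zeta_nonzero_Re_1[OF this s(2)] zero show False by simp
qed


section \<open>Growth of \<open>\<zeta>\<close> in a zero-free half plane\<close>

text \<open>The terms after the first are dominated by half a telescoping series of total 1. Thus
  |zeta| lies between 1/2 and 3/2, uniformly in the imaginary part.\<close>

lemma riemann_zeta_near_1:
  assumes "Re s \<ge> 3"
  shows "norm (riemann_zeta s - 1) \<le> 1 / 2"
proof -
  let ?f = "\<lambda>n. complex_of_nat (Suc n) powr (-s)"
  have "summable (\<lambda>n. norm (?f n))"
    using summable_Suc_powr[of "Re s"] assms by (simp add: norm_powr_real_powr del: of_nat_Suc)
  hence "?f sums riemann_zeta s"
    using assms by (simp add: riemann_zeta_eq_series dirichlet_series_def summable_norm_cancel[THEN summable_sums] del: of_nat_Suc)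
  hence "(\<lambda>n. ?f (Suc n)) sums (riemann_zeta s - ?f 0)"
    by (subst sums_Suc_iff) simp
  hence eq: "riemann_zeta s - 1 = (\<Sum>n. ?f (Suc n))" by (simp add: sums_iff)
  have tel: "(\<lambda>n. 1/2 * (1 / real (Suc n) - 1 / real (Suc (Suc n)))) sums (1/2 * (1 / real (Suc 0) - 0))"
    by (intro sums_mult telescope_sums' LIMSEQ_Suc lim_1_over_n)
  have "norm (\<Sum>n. ?f (Suc n)) \<le> (\<Sum>n. 1/2 * (1 / real (Suc n) - 1 / real (Suc (Suc n))))"
  proof (rule norm_suminf_le)
    fix n
    have "norm (?f (Suc n)) = real (Suc (Suc n)) powr (- Re s)"
      by (subst norm_powr_real_powr) auto
    also have "\<dots> \<le> real (Suc (Suc n)) powr (-3)" using assms by (intro powr_mono) auto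
    also have "\<dots> = 1 / real (Suc (Suc n)) ^ 3" by (simp add: powr_minus powr_numeral divide_inverse)
    also have "\<dots> \<le> 1/2 * (1 / real (Suc n) - 1 / real (Suc (Suc n)))"
    proof -
      have "2 * real (Suc n) \<le> real (Suc (Suc n)) ^ 2" by (simp add: power2_eq_square algebra_simps)
      thus ?thesis by (simp add: field_simps power2_eq_square power3_eq_cube del: of_nat_Suc)
         (simp add: algebra_simps)
    qed
    finally show "norm (?f (Suc n)) \<le> 1/2 * (1 / real (Suc n) - 1 / real (Suc (Suc n)))" .
  qed (use tel in \<open>rule sums_summable\<close>)
  thus ?thesis unfolding eq using sums_unique[OF tel] by simp
qed

text \<open>
  The functions \<open>\<zeta>(s + it)\<^bsup>1 / log |t|\<^esup>\<close> form a normal family as \<open>|t|\<close> grows. Limits have modulus 1 to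
  the right of 3, hence are constant, so that \<open>|\<zeta>(s + it)|\<^bsup>1 / log |t|\<^esup>\<close> tends to 1 everywhere.
\<close>

lemma riemann_zeta_subpolynomial:
  assumes \<beta>: "\<beta> > 0" and nz: "\<And>s. Re s > \<beta> \<Longrightarrow> s \<noteq> 1 \<Longrightarrow> riemann_zeta s \<noteq> 0"
    and \<sigma>: "\<sigma> > \<beta>" "\<sigma> < 4" and \<epsilon>: "\<epsilon> > 0"
  obtains T0 where "\<And>t. \<bar>t\<bar> \<ge> T0 \<Longrightarrow> norm (riemann_zeta (Complex \<sigma> t)) \<le> \<bar>t\<bar> powr \<epsilon>"
proof (rule ccontr)
  assume "\<not> thesis"
  \<comment> \<open>The 3 keeps the shifts away from the pole and makes ln |t| \<ge> 1; the summand
    n drives |t| to infinity.\<close>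
  hence "\<exists>t. \<bar>t\<bar> \<ge> real n + 3 \<and> norm (riemann_zeta (Complex \<sigma> t)) > \<bar>t\<bar> powr \<epsilon>" for n :: nat
    using that by (meson not_le)
  then obtain t where t: "\<And>n. \<bar>t n\<bar> \<ge> real n + 3"
    "\<And>n. norm (riemann_zeta (Complex \<sigma> (t n))) > \<bar>t n\<bar> powr \<epsilon>" by metis
  have t3: "\<bar>t n\<bar> \<ge> 3" for n using t(1)[of n] by simp
  \<comment> \<open>Convexity provides holomorphic logarithms, the height keeps the shifts by
    \<open>t n\<close> off the pole, and the right edge 4 leaves an overlap with Re s > 3, where
    zeta is near 1.\<close>
  define U where "U = {s. Re s > \<beta>} \<inter> {s. Re s < 4} \<inter> {s. Im s > -1} \<inter> {s. Im s < 1}"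
  have U: "open U" "convex U"
    unfolding U_def by (intro open_Int convex_Int open_halfspace_Re_gt open_halfspace_Re_lt
        open_halfspace_Im_gt open_halfspace_Im_lt convex_halfspace_Re_gt convex_halfspace_Re_lt
        convex_halfspace_Im_gt convex_halfspace_Im_lt)+
  have s0: "Complex \<sigma> 0 \<in> U" using \<sigma> by (simp add: U_def)
  define F where "F n s = riemann_zeta (s + \<i> * of_real (t n))" for n s
  have not1: "norm (s + \<i> * of_real (t n) - 1) \<ge> 1" if "s \<in> U" for s n
  proof -
    have "\<bar>Im (s + \<i> * of_real (t n) - 1)\<bar> \<ge> 1" using that t3[of n] by (auto simp: U_def)
    thus ?thesis using abs_Im_le_cmod order_trans by blast
  qed
  have F_nz: "F n s \<noteq> 0" if "s \<in> U" for n s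
    unfolding F_def using that not1[OF that, of n] by (intro nz) (auto simp: U_def)
  have F_hol: "F n holomorphic_on U" for n
  proof -
    have "(riemann_zeta \<circ> (\<lambda>s. s + \<i> * of_real (t n))) holomorphic_on U"
      by (intro holomorphic_on_compose_gen[OF _ riemann_zeta_holomorphic] holomorphic_intros)
         (use not1[of _ n] in force)
    thus ?thesis by (simp add: F_def[abs_def] o_def)
  qed
  have "\<exists>l. l holomorphic_on U \<and> (\<forall>s\<in>U. exp (l s) = F n s)" for n
    by (rule holomorphic_logarithm_exists[OF U(2,1) F_hol F_nz s0]) auto
  then obtain l where l: "\<And>n. l n holomorphic_on U" "\<And>n s. s \<in> U \<Longrightarrow> exp (l n s) = F n s" by metis
  have Re_l: "Re (l n s) = ln (norm (F n s))" if "s \<in> U" for n s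
    using l(2)[OF that, of n, symmetric] by simp
  define h where "h n s = exp (l n s / of_real (ln \<bar>t n\<bar>))" for n s
  have lnt: "ln \<bar>t n\<bar> \<ge> 1" for n
  proof -
    have "exp 1 \<le> \<bar>t n\<bar>" using exp_le t3[of n] by linarith
    thus ?thesis by (subst ln_ge_iff) (use t3[of n] in auto)
  qed
  have norm_h: "norm (h n s) = exp (ln (norm (F n s)) / ln \<bar>t n\<bar>)" if "s \<in> U" for n s
    unfolding h_def norm_exp_eq_Re using Re_l[OF that] by simp
  obtain C where C: "C \<ge> 1" "\<And>s. Re s \<ge> \<beta> \<Longrightarrow> norm (s - 1) \<ge> 1 \<Longrightarrow> norm (riemann_zeta s) \<le> C * (1 + norm s)"
    using riemann_zeta_bound[OF \<beta>] by blast
  \<comment> \<open>Linear growth gives |F| \<le> 3 C |t|; dividing the logarithm by ln |t| \<ge> 1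
    makes the bound independent of n, as Montel's theorem requires.\<close>
  have h_bound: "norm (h n s) \<le> exp (ln (3 * C) + 1)" if s: "s \<in> U" for n s
  proof -
    have "norm (F n s) \<le> C * (1 + norm (s + \<i> * of_real (t n)))"
      unfolding F_def using s by (intro C not1) (auto simp: U_def)
    also have "\<dots> \<le> C * (3 * \<bar>t n\<bar>)"
    proof (rule mult_left_mono)
      have "norm (s + \<i> * of_real (t n)) \<le> norm s + \<bar>t n\<bar>"
        by (rule order_trans[OF norm_triangle_ineq]) (simp add: norm_mult)
      moreover have "norm s \<le> \<bar>Re s\<bar> + \<bar>Im s\<bar>" by (rule cmod_le)
      ultimately show "1 + norm (s + \<i> * of_real (t n)) \<le> 3 * \<bar>t n\<bar>"
        using s t3[of n] \<beta> by (auto simp: U_def)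
    qed (use C in auto)
    finally have "ln (norm (F n s)) \<le> ln (3 * C * \<bar>t n\<bar>)"
      using F_nz[OF s, of n] C t3[of n] by (subst ln_le_cancel_iff) auto
    also have "\<dots> = ln (3 * C) + ln \<bar>t n\<bar>" using C t3[of n] by (subst ln_mult) auto
    finally have "ln (norm (F n s)) / ln \<bar>t n\<bar> \<le> (ln (3 * C) + ln \<bar>t n\<bar>) / ln \<bar>t n\<bar>"
      using lnt[of n] by (intro divide_right_mono) auto
    also have "\<dots> = ln (3 * C) / ln \<bar>t n\<bar> + 1" using lnt[of n] by (simp add: add_divide_distrib)
    also have "ln (3 * C) / ln \<bar>t n\<bar> \<le> ln (3 * C) / 1"
      using lnt[of n] C by (intro divide_left_mono) auto
    finally show ?thesis unfolding norm_h[OF s] by simp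
  qed
  obtain G r where G: "G holomorphic_on U" "strict_mono (r :: nat \<Rightarrow> nat)"
      "\<And>x. x \<in> U \<Longrightarrow> (\<lambda>n. h (r n) x) \<longlonglongrightarrow> G x"
  proof (rule Montel[of U "range h" h])
    show "f holomorphic_on U" if f: "f \<in> range h" for f
    proof -
      obtain n where "f = h n" using f by blast
      thus ?thesis unfolding h_def
        using lnt[of n] by (auto intro!: holomorphic_intros l)
    qed
    show "\<exists>B. \<forall>f\<in>range h. \<forall>z\<in>K. norm (f z) \<le> B" if "K \<subseteq> U" for K
      using that h_bound by (intro exI[of _ "exp (ln (3 * C) + 1)"]) auto
  qed (use U in auto)
  have lnt_top: "filterlim (\<lambda>n. ln \<bar>t n\<bar>) at_top sequentially"
  proof (rule filterlim_compose[OF ln_at_top])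
    have "real n \<le> \<bar>t n\<bar>" for n using t(1)[of n] by simp
    thus "filterlim (\<lambda>n. \<bar>t n\<bar>) at_top sequentially"
      by (intro filterlim_at_top_mono[OF filterlim_real_sequentially] always_eventually) auto
  qed
  have G1: "norm (G s) = 1" if s: "s \<in> U" "Re s > 3" for s
  proof -
    have "\<bar>ln (norm (F n s))\<bar> \<le> ln 2" for n
    proof -
      have "norm (F n s - 1) \<le> 1 / 2" unfolding F_def using s by (intro riemann_zeta_near_1) auto
      hence "norm (F n s) \<le> 2" "norm (F n s) \<ge> 1 / 2"
        using norm_triangle_ineq2[of "F n s" 1] norm_triangle_ineq2[of 1 "F n s"]
        by (auto simp: norm_minus_commute)
      hence "ln (norm (F n s)) \<le> ln 2" "ln (norm (F n s)) \<ge> ln (1 / 2)"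
        by (subst ln_le_cancel_iff; force)+
      thus ?thesis by (simp add: ln_div)
    qed
    hence "(\<lambda>n. ln (norm (F n s)) / ln \<bar>t n\<bar>) \<longlonglongrightarrow> 0"
      by (intro tendsto_0_le[OF tendsto_divide_0[OF tendsto_const[of "ln 2"] filterlim_at_top_imp_at_infinity[OF lnt_top]], where K = 1])
         (auto intro!: always_eventually divide_right_mono)
    hence "(\<lambda>n. exp (ln (norm (F n s)) / ln \<bar>t n\<bar>)) \<longlonglongrightarrow> exp 0"
      by (rule tendsto_exp)
    hence "(\<lambda>n. norm (h n s)) \<longlonglongrightarrow> 1" by (simp add: norm_h[OF s(1)])
    hence "(\<lambda>n. norm (h (r n) s)) \<longlonglongrightarrow> 1"
      using LIMSEQ_subseq_LIMSEQ[OF _ G(2)] by (auto simp: o_def)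
    moreover have "(\<lambda>n. norm (h (r n) s)) \<longlonglongrightarrow> norm (G s)" by (intro tendsto_norm G s)
    ultimately show ?thesis using LIMSEQ_unique by blast
  qed
  \<comment> \<open>Otherwise \<open>G\<close> maps a nonempty open set onto an open set inside the
    unit circle, which is a null set.\<close>
  have "G constant_on U"
  proof (rule ccontr)
    assume nc: "\<not> G constant_on U"
    define V where "V = U \<inter> {s. Re s > 3}"
    have "open (G ` V)"
      by (rule open_mapping_thm[OF G(1) U(1) convex_connected[OF U(2)] _ _ nc])
         (auto simp: V_def intro!: open_Int U open_halfspace_Re_gt)
    moreover have "G ` V \<subseteq> sphere 0 1" using G1 by (auto simp: V_def)
    moreover from this have "negligible (G ` V)" by (rule negligible_subset[OF negligible_sphere])
    ultimately have "V = {}" using open_not_negligible[of "G ` V"] by blast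
    moreover have "Complex ((max 3 \<beta> + 4) / 2) 0 \<in> V" using \<sigma> by (auto simp: V_def U_def max_def)
    ultimately show False by blast
  qed
  then obtain c where c: "\<And>s. s \<in> U \<Longrightarrow> G s = c" by (auto simp: constant_on_def)
  have "Complex ((max 3 \<beta> + 4) / 2) 0 \<in> U" "Re (Complex ((max 3 \<beta> + 4) / 2) 0) > 3"
    using \<sigma> by (auto simp: U_def max_def)
  hence "norm c = 1" using G1 c by metis
  hence "(\<lambda>n. norm (h (r n) (Complex \<sigma> 0))) \<longlonglongrightarrow> 1"
    using tendsto_norm[OF G(3)[OF s0]] c[OF s0] by simp
  \<comment> \<open>The heights \<open>t n\<close> were chosen so that |F| exceeds |t|^\<epsilon>
    here, which contradicts the limit 1.\<close>
  moreover have "norm (h n (Complex \<sigma> 0)) \<ge> exp \<epsilon>" for n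
  proof -
    have "Complex \<sigma> 0 + \<i> * of_real (t n) = Complex \<sigma> (t n)" by (simp add: complex_eq_iff)
    hence "norm (F n (Complex \<sigma> 0)) \<ge> \<bar>t n\<bar> powr \<epsilon>"
      using t(2)[of n] by (simp add: F_def)
    hence "ln (norm (F n (Complex \<sigma> 0))) \<ge> ln (\<bar>t n\<bar> powr \<epsilon>)"
      using t3[of n] F_nz[OF s0, of n] by (subst ln_le_cancel_iff) auto
    also have "ln (\<bar>t n\<bar> powr \<epsilon>) = \<epsilon> * ln \<bar>t n\<bar>" using t3[of n] by (simp add: ln_powr)
    finally show ?thesis unfolding norm_h[OF s0] using lnt[of n] by (simp add: le_divide_eq)
  qed
  ultimately have "1 \<ge> exp \<epsilon>" by (intro LIMSEQ_le_const) auto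
  thus False using \<epsilon> by simp
qed


section \<open>Mean squares left of the critical line\<close>

text \<open>The Gaussian serves as averaging weight because its Fourier transform is positive and
  decays fast: exponentials with well separated frequencies are almost orthogonal.\<close>

lemma has_bochner_integral_iexp_std_normal:
  "has_bochner_integral std_normal_distribution (\<lambda>x. iexp (t * x)) (of_real (exp (- t\<^sup>2 / 2)))"
proof -
  interpret real_distribution std_normal_distribution by (rule real_dist_normal_dist)
  have "integrable std_normal_distribution (\<lambda>x. iexp (t * x))"
    by (rule integrable_iexp) auto
  moreover have "(CLINT x|std_normal_distribution. iexp (t * x)) = of_real (exp (- t\<^sup>2 / 2))"
    using char_std_normal_distribution by (simp add: char_def fun_eq_iff)
  ultimately show ?thesis by (simp add: has_bochner_integral_iff)
qed

context
  fixes c :: "nat \<Rightarrow> complex" and l :: "nat \<Rightarrow> real" and P :: "nat \<Rightarrow> real \<Rightarrow> complex"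
  defines "P \<equiv> (\<lambda>M x. \<Sum>n<M. c n * iexp (l n * x))"
begin

text \<open>The lengths \<open>M\<close> and \<open>N\<close> are independent because the cross term
  of |P_M - P_N|^2 is needed.\<close>

lemma trig_poly_inner:
  "has_bochner_integral std_normal_distribution (\<lambda>x. P M x * cnj (P N x))
     (\<Sum>n<N. \<Sum>m<M. c m * cnj (c n) * of_real (exp (- (l m - l n)\<^sup>2 / 2)))"
proof -
  have "P M x * cnj (P N x) = (\<Sum>n<N. \<Sum>m<M. c m * cnj (c n) * iexp ((l m - l n) * x))" for x
  proof -
    have "P M x * cnj (P N x) = (\<Sum>m<M. \<Sum>n<N. (c m * iexp (l m * x)) * (cnj (c n) * iexp (- (l n * x))))"
      by (simp add: P_def sum_product exp_cnj)
    also have "\<dots> = (\<Sum>m<M. \<Sum>n<N. c m * cnj (c n) * iexp ((l m - l n) * x))"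
      by (intro sum.cong refl) (simp add: ring_distribs exp_diff exp_minus field_simps)
    also have "\<dots> = (\<Sum>n<N. \<Sum>m<M. c m * cnj (c n) * iexp ((l m - l n) * x))"
      by (rule sum.swap)
    finally show ?thesis .
  qed
  thus ?thesis
    by (simp only:) (intro has_bochner_integral_sum has_bochner_integral_mult_right has_bochner_integral_iexp_std_normal)
qed

lemma trig_poly_norm_squared:
  "has_bochner_integral std_normal_distribution (\<lambda>x. norm (P M x) ^ 2)
     (Re (\<Sum>n<M. \<Sum>m<M. c m * cnj (c n) * of_real (exp (- (l m - l n)\<^sup>2 / 2))))"
proof -
  have "norm (P M x) ^ 2 = Re (P M x * cnj (P M x))" for x
    by (simp flip: complex_norm_square)
  thus ?thesis
    using has_bochner_integral_bounded_linear[OF bounded_linear_Re trig_poly_inner[of M M]] by simp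
qed

text \<open>
  Expanding \<open>0 \<le> \<integral>|P\<^sub>M - P\<^sub>N|\<^sup>2\<close> bounds the mean square of \<open>P\<^sub>M\<close> from below by quantities in which one
  frequency has index less than \<open>N\<close>.
\<close>

lemma trig_poly_mean_square_ge:
  assumes c: "\<And>n. norm (c n) \<le> 1" and "N \<le> M"
    and R: "(\<Sum>n<N. \<Sum>m\<in>{..<M} - {n}. exp (- (l m - l n)\<^sup>2 / 2)) \<le> R"
  shows "(LINT x|std_normal_distribution. norm (P M x) ^ 2) \<ge> (\<Sum>n<N. norm (c n) ^ 2) - 3 * R"
proof -
  define I where "I M N = (\<Sum>n<N. \<Sum>m<M. c m * cnj (c n) * of_real (exp (- (l m - l n)\<^sup>2 / 2)))" for M N
  \<comment> \<open>\<open>R\<close> controls pairs whose second index is below \<open>N\<close>,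
    hence both \<open>I M N\<close> and \<open>I N N\<close>, but in general not
    \<open>I M M\<close>.\<close>
  have I: "norm (I K N - of_real (\<Sum>n<N. norm (c n) ^ 2)) \<le> R" if K: "N \<le> K" "K \<le> M" for K
  proof -
    have "I K N = (\<Sum>n<N. of_real (norm (c n) ^ 2) + (\<Sum>m\<in>{..<K} - {n}. c m * cnj (c n) * of_real (exp (- (l m - l n)\<^sup>2 / 2))))"
      unfolding I_def
    proof (rule sum.cong[OF refl])
      fix n assume "n \<in> {..<N}"
      thus "(\<Sum>m<K. c m * cnj (c n) * of_real (exp (- (l m - l n)\<^sup>2 / 2))) =
         of_real (norm (c n) ^ 2) + (\<Sum>m\<in>{..<K} - {n}. c m * cnj (c n) * of_real (exp (- (l m - l n)\<^sup>2 / 2)))"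
        using K complex_norm_square[of "c n"] by (subst sum.remove[of _ n]) auto
    qed
    hence "I K N - of_real (\<Sum>n<N. norm (c n) ^ 2) =
        (\<Sum>n<N. \<Sum>m\<in>{..<K} - {n}. c m * cnj (c n) * of_real (exp (- (l m - l n)\<^sup>2 / 2)))"
      by (simp add: sum.distrib)
    also have "norm \<dots> \<le> (\<Sum>n<N. \<Sum>m\<in>{..<K} - {n}. exp (- (l m - l n)\<^sup>2 / 2))"
    proof (intro sum_norm_le)
      fix m n
      have "norm (c m) * norm (c n) * exp (- (l m - l n)\<^sup>2 / 2) \<le> 1 * 1 * exp (- (l m - l n)\<^sup>2 / 2)"
        by (intro mult_right_mono mult_mono c) auto
      thus "norm (c m * cnj (c n) * of_real (exp (- (l m - l n)\<^sup>2 / 2))) \<le> exp (- (l m - l n)\<^sup>2 / 2)"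
        by (simp add: norm_mult)
    qed
    also have "\<dots> \<le> (\<Sum>n<N. \<Sum>m\<in>{..<M} - {n}. exp (- (l m - l n)\<^sup>2 / 2))"
      using K by (intro sum_mono sum_mono2) auto
    finally show ?thesis using R by simp
  qed
  have ReI: "\<bar>Re (I K N) - (\<Sum>n<N. norm (c n) ^ 2)\<bar> \<le> R" if "N \<le> K" "K \<le> M" for K
    using order_trans[OF abs_Re_le_cmod I[OF that]] by simp
  have "has_bochner_integral std_normal_distribution (\<lambda>x. norm (P M x - P N x) ^ 2)
      (Re (I M M) - 2 * Re (I M N) + Re (I N N))"
  proof -
    have "norm (P M x - P N x) ^ 2 = norm (P M x) ^ 2 - 2 * Re (P M x * cnj (P N x)) + norm (P N x) ^ 2" for x
      unfolding cmod_power2 by (simp add: power2_eq_square algebra_simps)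
    thus ?thesis unfolding I_def
      by (simp only:) (intro has_bochner_integral_add has_bochner_integral_diff has_bochner_integral_mult_right
         trig_poly_norm_squared has_bochner_integral_bounded_linear[OF bounded_linear_Re trig_poly_inner])
  qed
  hence "Re (I M M) - 2 * Re (I M N) + Re (I N N) \<ge> 0"
    using has_bochner_integral_integral_eq integral_nonneg_AE
    by (metis (no_types, lifting) AE_I2 zero_le_power2)
  moreover have "(LINT x|std_normal_distribution. norm (P M x) ^ 2) = Re (I M M)"
    unfolding I_def by (rule has_bochner_integral_integral_eq[OF trig_poly_norm_squared])
  \<comment> \<open>With S the sum of |c n|^2 over n < N, nonnegativity gives Re (I M M) \<ge> 2 (S
    - R) - (S + R) = S - 3 R.\<close>
  ultimately show ?thesis
    using ReI[of M] ReI[of N] \<open>N \<le> M\<close> by linarith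
qed

end

section \<open>Separation of the frequencies N^2 ln n\<close>

text \<open>For m \<le> 2 N the logarithms differ by at least 1 / (2 N), so the scaled gap is at
  least N / 2 and the Gaussian at most exp (- N^2 / 8). For larger m the unscaled gap is at least ln
  (m / N) \<ge> ln 2. The bound 1 / (N m^2) is shaped for summation over N values of n and all
  m.\<close>

lemma ln_quotient_bound:
  fixes m n N :: real
  assumes "1 \<le> n" "n \<le> N" "1 \<le> m" "\<bar>m - n\<bar> \<ge> 1"
    and N1: "N^2 / 8 \<ge> 2 * ln (2 * N) + ln N" and N2: "N \<ge> 5"
  shows "exp (- (N^2 * ln m - N^2 * ln n)\<^sup>2 / 2) \<le> 1 / (N * m\<^sup>2)"
proof -
  have lower: "ln x - ln y \<ge> 1 / x" if "x - y \<ge> 1" "y \<ge> 1" for x y :: real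
  proof -
    have "ln (y / x) \<le> y / x - 1" using that by (intro ln_le_minus_one) auto
    also have "\<dots> = - ((x - y) / x)" using that by (simp add: field_simps)
    also have "\<dots> \<le> - (1 / x)" using that by (simp add: divide_right_mono)
    finally show ?thesis using that by (simp add: ln_div)
  qed
  have "2 * ln m + ln N \<le> (N^2 * ln m - N^2 * ln n)\<^sup>2 / 2"
  proof (cases "m \<le> 2 * N")
    case True
    have "\<bar>ln m - ln n\<bar> \<ge> 1 / (2 * N)"
    proof (cases "m > n")
      case True
      hence "ln m - ln n \<ge> 1 / m" using assms by (intro lower) auto
      moreover have "1 / m \<ge> 1 / (2 * N)" using \<open>m \<le> 2 * N\<close> assms by (intro divide_left_mono) auto
      ultimately show ?thesis by linarith
    next
      case False
      hence "ln n - ln m \<ge> 1 / n" using assms by (intro lower) auto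
      moreover have "1 / n \<ge> 1 / (2 * N)" using assms by (intro divide_left_mono) auto
      ultimately show ?thesis by linarith
    qed
    hence "(1 / (2 * N))\<^sup>2 \<le> \<bar>ln m - ln n\<bar>\<^sup>2" using N2 by (intro power_mono) auto
    hence "(N^2)\<^sup>2 * (1 / (2 * N))\<^sup>2 \<le> (N^2)\<^sup>2 * (ln m - ln n)\<^sup>2" by (intro mult_left_mono) auto
    also have "(N^2)\<^sup>2 * (1 / (2 * N))\<^sup>2 = N^2 / 4" using N2 by (simp add: power2_eq_square)
    also have "(N^2)\<^sup>2 * (ln m - ln n)\<^sup>2 = (N^2 * ln m - N^2 * ln n)\<^sup>2"
      by (simp add: power2_eq_square algebra_simps)
    finally have "N^2 / 8 \<le> (N^2 * ln m - N^2 * ln n)\<^sup>2 / 2" by simp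
    moreover have "ln m \<le> ln (2 * N)" using True assms by (subst ln_le_cancel_iff) auto
    ultimately show ?thesis using N1 by linarith
  next
    case False
    define v where "v = ln m - ln N"
    have "ln 2 \<le> ln (m / N)" using False N2 assms by (subst ln_le_cancel_iff) (auto simp: field_simps)
    hence "v \<ge> ln 2" using N2 assms by (simp add: v_def ln_div)
    \<comment> \<open>The inequality ln 2 \<ge> 1/2 comes from ln (1/2) \<le> -1/2.\<close>
    hence v: "v \<ge> 1/2" using ln_le_minus_one[of "1/2 :: real"] by (simp add: ln_div)
    have lnN: "ln N \<le> N - 1" using N2 by (intro ln_le_minus_one) auto
    have N4: "N^4 \<ge> 125 * N"
    proof -
      have "5 ^ 3 \<le> N ^ 3" using N2 by (intro power_mono) auto
      hence "5 ^ 3 * N \<le> N ^ 3 * N" using N2 by (intro mult_right_mono) auto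
      thus ?thesis by (simp add: power_numeral_reduce)
    qed
    \<comment> \<open>The left side is \<open>2 * ln m + ln N\<close> after substituting ln m = v +
      ln N.\<close>
    have "2 * v + 3 * ln N \<le> N^4 * v\<^sup>2 / 2"
    proof -
      have "(N^4 / 4 - 2) * v \<ge> (N^4 / 4 - 2) * (1/2)" using v N4 N2 by (intro mult_left_mono) auto
      hence 1: "N^4 * v / 4 - 2 * v \<ge> N^4 / 8 - 1" by (simp only: left_diff_distrib)
      have "N^4 * v\<^sup>2 \<ge> N^4 * (v * (1/2))"
        unfolding power2_eq_square using v N2 by (intro mult_left_mono) auto
      hence "N^4 * v\<^sup>2 \<ge> N^4 * v / 2" by simp
      thus ?thesis using 1 lnN N4 N2 by linarith
    qed
    also have "N^4 * v\<^sup>2 \<le> N^4 * (ln m - ln n)\<^sup>2"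
    proof -
      have "ln n \<le> ln N" using assms by simp
      hence "v \<le> ln m - ln n" by (simp add: v_def)
      thus ?thesis using v N2 by (intro mult_left_mono power_mono) auto
    qed
    also have "\<dots> = (N^2 * ln m - N^2 * ln n)\<^sup>2"
      by (simp add: power2_eq_square power_numeral_reduce algebra_simps)
    finally show ?thesis by (simp add: v_def divide_right_mono)
  qed
  hence "exp (- (N^2 * ln m - N^2 * ln n)\<^sup>2 / 2) \<le> exp (- (2 * ln m + ln N))" by simp
  also have "2 * ln m + ln N = ln (N * m\<^sup>2)" using assms by (simp add: ln_mult ln_realpow)
  also have "exp (- ln (N * m\<^sup>2)) = 1 / (N * m\<^sup>2)" using assms by (simp add: exp_minus field_simps)
  finally show ?thesis .
qed

lemma sum_inverse_squares_le_2: "(\<Sum>m<M. 1 / (real (Suc m))\<^sup>2) \<le> 2"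
proof -
  have "(\<Sum>m<Suc M. 1 / (real (Suc m))\<^sup>2) \<le> 2 - 1 / real (Suc M)" for M
  proof (induction M)
    case (Suc M)
    have "1 / (real (Suc (Suc M)))\<^sup>2 \<le> 1 / real (Suc M) - 1 / real (Suc (Suc M))"
    proof -
      have "1 / (real (Suc (Suc M)))\<^sup>2 \<le> 1 / (real (Suc M) * real (Suc (Suc M)))"
        unfolding power2_eq_square by (intro divide_left_mono mult_right_mono) auto
      also have "\<dots> = 1 / real (Suc M) - 1 / real (Suc (Suc M))" by (simp add: divide_simps)
      finally show ?thesis .
    qed
    thus ?case using Suc.IH by (subst sum.lessThan_Suc) linarith
  qed simp
  note this[of M]
  moreover have "1 / real (Suc M) \<ge> 0" "1 / (real (Suc M))\<^sup>2 \<ge> 0" by simp_all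
  ultimately show ?thesis by (simp only: sum.lessThan_Suc)
qed

text \<open>The N values of n cancel the 1 / N of \<open>ln_quotient_bound\<close>. The minus signs
  match the frequencies of n^(-it) at t = N^2 x.\<close>

lemma off_diagonal_sum_le:
  assumes "real N^2 / 8 \<ge> 2 * ln (2 * real N) + ln (real N)" "N \<ge> 5"
  shows "(\<Sum>n<N. \<Sum>m\<in>{..<M} - {n}. exp (- (- (real N^2 * ln (real (Suc m))) - - (real N^2 * ln (real (Suc n))))\<^sup>2 / 2)) \<le> 2"
proof -
  have "(\<Sum>n<N. \<Sum>m\<in>{..<M} - {n}. exp (- (- (real N^2 * ln (real (Suc m))) - - (real N^2 * ln (real (Suc n))))\<^sup>2 / 2))
     \<le> (\<Sum>n<N. \<Sum>m\<in>{..<M} - {n}. 1 / (real N * (real (Suc m))\<^sup>2))"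
  proof (intro sum_mono)
    fix n m assume "n \<in> {..<N}" "m \<in> {..<M} - {n}"
    hence "exp (- (real N^2 * ln (real (Suc m)) - real N^2 * ln (real (Suc n)))\<^sup>2 / 2) \<le> 1 / (real N * (real (Suc m))\<^sup>2)"
      using assms by (intro ln_quotient_bound) auto
    moreover have "(- (real N^2 * ln (real (Suc m))) - - (real N^2 * ln (real (Suc n))))\<^sup>2
       = (real N^2 * ln (real (Suc m)) - real N^2 * ln (real (Suc n)))\<^sup>2"
      by (simp add: power2_commute)
    ultimately show "exp (- (- (real N^2 * ln (real (Suc m))) - - (real N^2 * ln (real (Suc n))))\<^sup>2 / 2) \<le> 1 / (real N * (real (Suc m))\<^sup>2)"
      by simp
  qed
  also have "\<dots> \<le> (\<Sum>n<N. \<Sum>m<M. 1 / (real N * (real (Suc m))\<^sup>2))"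
    by (intro sum_mono sum_mono2) auto
  also have "\<dots> = (\<Sum>m<M. 1 / (real (Suc m))\<^sup>2)"
    using assms(2) by (simp add: sum_distrib_left field_simps del: of_nat_Suc)
  also have "\<dots> \<le> 2" by (rule sum_inverse_squares_le_2)
  finally show ?thesis .
qed

text \<open>After t = T x, both the assumed growth of the series and its truncation error are at
  most a factor independent of x times 1 + |x|; this integrates the square.\<close>

lemma std_normal_second_moment_bound:
  "integrable std_normal_distribution (\<lambda>x. (1 + \<bar>x\<bar>)\<^sup>2)"
  "(LINT x|std_normal_distribution. (1 + \<bar>x\<bar>)\<^sup>2) \<le> 4"
proof -
  interpret real_distribution std_normal_distribution by (rule real_dist_normal_dist)
  have i2: "integrable std_normal_distribution (\<lambda>x. 2 + 2 * x\<^sup>2)"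
    using integrable_std_normal_distribution_moment[of 2] by simp
  have le: "(1 + \<bar>x\<bar>)\<^sup>2 \<le> 2 + 2 * x\<^sup>2" for x :: real
    using zero_le_power2[of "1 - \<bar>x\<bar>"] by (simp add: power2_eq_square algebra_simps)
  show i: "integrable std_normal_distribution (\<lambda>x. (1 + \<bar>x\<bar>)\<^sup>2)"
    by (rule Bochner_Integration.integrable_bound[OF i2]) (use le in auto)
  have "(LINT x|std_normal_distribution. (1 + \<bar>x\<bar>)\<^sup>2) \<le> (LINT x|std_normal_distribution. 2 + 2 * x\<^sup>2)"
    by (rule integral_mono[OF i i2 le])
  also have "\<dots> = 4"
    using std_normal_distribution_even_moments[of 1] prob_space
    by (subst Bochner_Integration.integral_add) (auto simp: integrable_std_normal_distribution_moment)
  finally show "(LINT x|std_normal_distribution. (1 + \<bar>x\<bar>)\<^sup>2) \<le> 4" .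
qed

text \<open>
  Left of the critical line a Dirichlet series with coefficients of modulus 1 cannot be bounded by
  small powers of \<open>|t|\<close>: its mean square against a Gaussian of width \<open>N\<^sup>2\<close> is at least that of its
  first \<open>N\<close> terms.
\<close>

lemma dirichlet_series_not_subpolynomial:
  fixes a :: "nat \<Rightarrow> complex"
  assumes a: "\<And>n. norm (a (Suc n)) = 1"
    and A: "\<And>N. norm (\<Sum>n<N. a (Suc n)) \<le> C * real N powr 0"
    and \<sigma>: "0 < \<sigma>" "\<sigma> < 1 / 2" and \<epsilon>: "0 < \<epsilon>" "4 * \<epsilon> < 1 - 2 * \<sigma>"
    and bound: "\<And>t. norm (dirichlet_series a (Complex \<sigma> t)) \<le> B * (1 + \<bar>t\<bar>) powr \<epsilon>"
  shows False
proof -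
  obtain e where e: "e \<longlonglongrightarrow> 0"
    "\<And>s M. Re s \<ge> \<sigma> \<Longrightarrow> norm (dirichlet_series a s - (\<Sum>n<M. a (Suc n) * of_nat (Suc n) powr (-s)))
        \<le> (1 + norm s) * e M"
    by (rule dirichlet_series_tail[OF A, of \<sigma>]) (use \<sigma> in auto)
  have B: "B \<ge> 0" using order_trans[OF norm_ge_zero bound[of 0]] by simp
  \<comment> \<open>The first N terms contribute at least N^(1 - 2\<sigma>) less 3 * 2 for the
    off-diagonal pairs, while the growth bound allows only a multiple of N^(4\<epsilon>). For large
    N this contradicts 4\<epsilon> < 1 - 2\<sigma>.\<close>
  have key: "real N powr (1 - 2 * \<sigma>) \<le> 6 + 8 * B\<^sup>2 * real N powr (4 * \<epsilon>)"
    if N: "real N^2 / 8 \<ge> 2 * ln (2 * real N) + ln (real N)" "N \<ge> 5" for N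
  proof -
    \<comment> \<open>Neighbouring logarithms near ln N are about 1 / N apart, so scaling by N^2
      separates them by about N.\<close>
    define T where "T = real N ^ 2"
    have T: "T \<ge> 1" using N by (simp add: T_def)
    define c where "c n = a (Suc n) * of_real (real (Suc n) powr (-\<sigma>))" for n
    define l where "l n = - (T * ln (real (Suc n)))" for n
    define P where "P M x = (\<Sum>n<M. c n * iexp (l n * x))" for M x
    have P: "(\<Sum>n<M. a (Suc n) * of_nat (Suc n) powr (- Complex \<sigma> (T * x))) = P M x" for M x
      unfolding P_def c_def l_def mult.assoc
    proof (intro sum.cong refl arg_cong2[where f = times])
      fix n
      have "- Complex \<sigma> (T * x) = of_real (- \<sigma>) + \<i> * of_real (- (T * x))" by (simp add: complex_eq_iff)
      thus "of_nat (Suc n) powr (- Complex \<sigma> (T * x)) =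
         complex_of_real (real (Suc n) powr (-\<sigma>)) * iexp (- (T * ln (real (Suc n))) * x)"
        by (simp only: powr_add) (simp add: powr_def exp_minus exp_of_real Ln_of_nat mult_ac del: of_nat_Suc flip: of_real_mult)
    qed
    have c: "norm (c n) = real (Suc n) powr (-\<sigma>)" for n
      using a[of n] by (simp add: c_def norm_mult)
    have "norm (c n) \<le> 1" for n
      unfolding c using \<sigma> powr_mono[of "-\<sigma>" 0 "real (Suc n)"] by simp
    hence lower: "(LINT x|std_normal_distribution. norm (P M x) ^ 2) \<ge> (\<Sum>n<N. norm (c n) ^ 2) - 3 * 2"
      if "N \<le> M" for M
      unfolding P_def
      by (rule trig_poly_mean_square_ge[OF _ that])
         (use off_diagonal_sum_le[OF N, of M] in \<open>auto simp: l_def T_def\<close>)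
    have upper: "(LINT x|std_normal_distribution. norm (P M x) ^ 2)
        \<le> 4 * (2 * B\<^sup>2 * T powr (2 * \<epsilon>) + 8 * T\<^sup>2 * (e M)\<^sup>2)" for M
    proof -
      define K where "K = 2 * B\<^sup>2 * T powr (2 * \<epsilon>) + 8 * T\<^sup>2 * (e M)\<^sup>2"
      have "norm (P M x) ^ 2 \<le> K * (1 + \<bar>x\<bar>)\<^sup>2" for x
      proof -
        define s where "s = Complex \<sigma> (T * x)"
        define D where "D = dirichlet_series a s"
        have d1: "norm D ^ 2 \<le> B\<^sup>2 * T powr (2 * \<epsilon>) * (1 + \<bar>x\<bar>)\<^sup>2"
        proof -
          have "1 + \<bar>T * x\<bar> \<le> T * (1 + \<bar>x\<bar>)" using T by (simp add: abs_mult algebra_simps)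
          hence "(1 + \<bar>T * x\<bar>) powr \<epsilon> \<le> (T * (1 + \<bar>x\<bar>)) powr \<epsilon>" using \<epsilon> by (intro powr_mono2) auto
          also have "\<dots> = T powr \<epsilon> * (1 + \<bar>x\<bar>) powr \<epsilon>" using T by (simp add: powr_mult)
          \<comment> \<open>The loss in x is harmless under the Gaussian; only the power of
            \<open>T\<close> must keep \<epsilon>.\<close>
          also have "(1 + \<bar>x\<bar>) powr \<epsilon> \<le> (1 + \<bar>x\<bar>) powr 1" using \<epsilon> \<sigma> by (intro powr_mono) auto
          finally have "norm D \<le> B * (T powr \<epsilon> * (1 + \<bar>x\<bar>))"
            using order_trans[OF bound[of "T * x"] mult_left_mono[OF _ B]] T
            by (simp add: D_def s_def mult_left_mono)
          hence "norm D ^ 2 \<le> (B * (T powr \<epsilon> * (1 + \<bar>x\<bar>))) ^ 2" by (intro power_mono) auto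
          thus ?thesis by (simp add: power_mult_distrib power2_eq_square[of "T powr \<epsilon>"] mult.assoc flip: powr_add)
        qed
        have d2: "norm (D - P M x) ^ 2 \<le> 4 * T\<^sup>2 * (e M)\<^sup>2 * (1 + \<bar>x\<bar>)\<^sup>2"
        proof -
          have ns: "1 + norm s \<le> 2 * T * (1 + \<bar>x\<bar>)"
          proof -
            have "norm s \<le> \<bar>\<sigma>\<bar> + \<bar>T * x\<bar>" using cmod_le[of s] by (simp add: s_def)
            moreover have "\<bar>T * x\<bar> = T * \<bar>x\<bar>" "T * \<bar>x\<bar> \<ge> 0" using T by (simp_all add: abs_mult)
            moreover have "2 * T * (1 + \<bar>x\<bar>) = 2 * T + 2 * (T * \<bar>x\<bar>)" by (simp add: algebra_simps)
            ultimately show ?thesis using T \<sigma> by linarith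
          qed
          have "norm (D - P M x) \<le> (1 + norm s) * e M"
            using e(2)[of s M] P[of x M] by (simp add: s_def D_def)
          also have "\<dots> \<le> (1 + norm s) * \<bar>e M\<bar>" by (intro mult_left_mono) auto
          also have "\<dots> \<le> (2 * T * (1 + \<bar>x\<bar>)) * \<bar>e M\<bar>" using ns by (intro mult_right_mono) auto
          finally have "norm (D - P M x) ^ 2 \<le> ((2 * T * (1 + \<bar>x\<bar>)) * \<bar>e M\<bar>) ^ 2" by (intro power_mono) auto
          thus ?thesis unfolding power_mult_distrib by (simp add: mult_ac)
        qed
        have "norm (P M x) \<le> norm D + norm (D - P M x)"
          using norm_triangle_ineq4[of D "D - P M x"] by simp
        hence "norm (P M x) ^ 2 \<le> (norm D + norm (D - P M x)) ^ 2" by (intro power_mono) auto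
        also have "\<dots> \<le> 2 * norm D ^ 2 + 2 * norm (D - P M x) ^ 2"
          using zero_le_power2[of "norm D - norm (D - P M x)"] by (simp add: power2_eq_square algebra_simps)
        also have "\<dots> \<le> K * (1 + \<bar>x\<bar>)\<^sup>2" using d1 d2 by (simp add: K_def algebra_simps)
        finally show ?thesis .
      qed
      hence "(LINT x|std_normal_distribution. norm (P M x) ^ 2) \<le> (LINT x|std_normal_distribution. K * (1 + \<bar>x\<bar>)\<^sup>2)"
        using std_normal_second_moment_bound(1) trig_poly_norm_squared[of c l M]
        by (intro integral_mono) (auto simp: P_def has_bochner_integral_iff)
      also have "\<dots> = K * (LINT x|std_normal_distribution. (1 + \<bar>x\<bar>)\<^sup>2)" by simp
      also have "\<dots> \<le> K * 4"
        by (intro mult_left_mono std_normal_second_moment_bound(2)) (simp add: K_def)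
      finally show ?thesis by (simp add: K_def)
    qed
    \<comment> \<open>\<open>N\<close> and \<open>T\<close> stay fixed while M tends to infinity, so
      the truncation error vanishes despite its factor \<open>T\<^sup>2\<close>.\<close>
    have "(\<lambda>M. 4 * (2 * B\<^sup>2 * T powr (2 * \<epsilon>) + 8 * T\<^sup>2 * (e M)\<^sup>2)) \<longlonglongrightarrow> 4 * (2 * B\<^sup>2 * T powr (2 * \<epsilon>) + 8 * T\<^sup>2 * 0\<^sup>2)"
      by (intro tendsto_intros e)
    moreover have "(\<Sum>n<N. norm (c n) ^ 2) - 3 * 2 \<le> 4 * (2 * B\<^sup>2 * T powr (2 * \<epsilon>) + 8 * T\<^sup>2 * (e M)\<^sup>2)"
      if "N \<le> M" for M
      using lower[OF that] upper[of M] by linarith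
    ultimately have "(\<Sum>n<N. norm (c n) ^ 2) - 3 * 2 \<le> 4 * (2 * B\<^sup>2 * T powr (2 * \<epsilon>) + 8 * T\<^sup>2 * 0\<^sup>2)"
      by (intro LIMSEQ_le_const) auto
    moreover have "(\<Sum>n<N. norm (c n) ^ 2) \<ge> (\<Sum>n<N. real N powr (- 2 * \<sigma>))"
    proof (rule sum_mono)
      fix n assume "n \<in> {..<N}"
      hence "real N powr (- 2 * \<sigma>) \<le> real (Suc n) powr (- 2 * \<sigma>)"
        using \<sigma> by (intro powr_mono2') auto
      thus "real N powr (- 2 * \<sigma>) \<le> norm (c n) ^ 2"
        by (simp add: c power2_eq_square del: of_nat_Suc flip: powr_add)
    qed
    moreover have "(\<Sum>n<N. real N powr (- 2 * \<sigma>)) = real N powr (1 - 2 * \<sigma>)"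
      using N(2) powr_add[of "real N" 1 "- 2 * \<sigma>"] by simp
    moreover have "T powr (2 * \<epsilon>) = real N powr (4 * \<epsilon>)"
      using N(2) powr_powr[of "real N" 2 "2 * \<epsilon>"] by (simp add: T_def)
    ultimately show ?thesis by simp
  qed
  have "eventually (\<lambda>N::nat. real N^2 / 8 \<ge> 2 * ln (2 * real N) + ln (real N)) at_top" by real_asymp
  moreover have "eventually (\<lambda>N::nat. real N powr (1 - 2 * \<sigma>) > 6 + 8 * B\<^sup>2 * real N powr (4 * \<epsilon>)) at_top"
    using \<sigma> \<epsilon> by real_asymp
  ultimately have "eventually (\<lambda>N::nat. False) at_top"
    using eventually_ge_at_top[of 5] by eventually_elim (use key in force)
  thus False by simp
qed


section \<open>Zeros of \<open>\<zeta>\<close> near the critical line\<close>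

text \<open>Coefficients of the Dirichlet eta function: of modulus 1 and with bounded partial sums,
  so its series represents the continuation for Re s > 0 and the mean square argument applies to
  it.\<close>

definition eta_coeff :: "nat \<Rightarrow> complex" where
  "eta_coeff n = (-1) ^ Suc n"

lemma eta_coeff_partial_sums: "norm (\<Sum>n<N. eta_coeff (Suc n)) \<le> 1 * real N powr 0"
proof (cases "N = 0")
  case False
  have "(\<Sum>n<N. eta_coeff (Suc n)) = (if even N then 0 else 1)" for N
    by (induction N) (auto simp: eta_coeff_def)
  thus ?thesis using False by simp
qed simp

text \<open>For Re s > 1, subtracting the even-indexed terms twice alternates the signs, and those
  terms sum to 2^(-s) zeta(s). The identity theorem extends this.\<close>

lemma eta_eq_zeta:
  assumes "Re s > 0" "s \<noteq> 1"
  shows "dirichlet_series eta_coeff s = (1 - 2 powr (1 - s)) * riemann_zeta s"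
proof (rule analytic_continuation_open[of "{s. Re s > 1}" "{s. Re s > 0} - {1}" "dirichlet_series eta_coeff"
      "\<lambda>s. (1 - 2 powr (1 - s)) * riemann_zeta s"])
  show "open ({s. Re s > 0} - {1})" by (intro open_Diff open_halfspace_Re_gt) auto
  show "connected ({s. Re s > 0} - {1})"
    by (intro connected_open_delete open_halfspace_Re_gt convex_connected convex_halfspace_Re_gt) auto
  show "{s. 1 < Re s} \<noteq> {}" by (auto intro: exI[of _ 2])
  show "dirichlet_series eta_coeff holomorphic_on ({s. Re s > 0} - {1})"
    by (rule holomorphic_on_subset[OF dirichlet_series_holomorphic[OF eta_coeff_partial_sums]]) auto
  show "(\<lambda>s. (1 - 2 powr (1 - s)) * riemann_zeta s) holomorphic_on ({s. Re s > 0} - {1})"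
    by (intro holomorphic_intros holomorphic_on_subset[OF riemann_zeta_holomorphic]) auto
  show "dirichlet_series eta_coeff s = (1 - 2 powr (1 - s)) * riemann_zeta s" if "s \<in> {s. Re s > 1}" for s
  proof -
    let ?b = "\<lambda>n. of_nat n powr (-s) :: complex"
    have s: "Re s > 1" using that by simp
    have z: "(?b has_sum riemann_zeta s) {0<..}"
      using dirichlet_series_has_sum[of "\<lambda>_. 1" s] s by (simp add: riemann_zeta_eq_series)
    have "((\<lambda>n. 2 powr (-s) * ?b n) has_sum 2 powr (-s) * riemann_zeta s) {0<..}"
      by (intro has_sum_cmult_right z)
    also have "?this \<longleftrightarrow> ((?b \<circ> (*) 2) has_sum 2 powr (-s) * riemann_zeta s) {0<..}"
      using of_nat_powr_mult[of 2 _ "-s"] by (intro has_sum_cong) (auto simp: o_def)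
    also have "\<dots> \<longleftrightarrow> (?b has_sum 2 powr (-s) * riemann_zeta s) ((*) 2 ` {0<..})"
      by (rule has_sum_reindex[symmetric]) (auto intro: inj_onI)
    also have "\<dots> \<longleftrightarrow> ((\<lambda>n. if even n then ?b n else 0) has_sum 2 powr (-s) * riemann_zeta s) {0<..}"
      by (rule has_sum_cong_neutral) (auto elim!: evenE)
    finally have "((\<lambda>n. ?b n + (- 2) * (if even n then ?b n else 0)) has_sum
        (riemann_zeta s + (- 2) * (2 powr (-s) * riemann_zeta s))) {0<..}"
      by (intro has_sum_add z has_sum_cmult_right)
    also have "?this \<longleftrightarrow> ((\<lambda>n. eta_coeff n * ?b n) has_sum
        (riemann_zeta s + (- 2) * (2 powr (-s) * riemann_zeta s))) {0<..}"
      by (rule has_sum_cong) (auto simp: eta_coeff_def)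
    finally have "dirichlet_series eta_coeff s = riemann_zeta s + (- 2) * (2 powr (-s) * riemann_zeta s)"
      using dirichlet_series_has_sum[of eta_coeff s] s
      by (auto intro: has_sum_unique simp: eta_coeff_def norm_power)
    thus ?thesis by (simp add: powr_diff powr_minus field_simps)
  qed
qed (use assms in \<open>auto simp: open_halfspace_Re_gt\<close>)

text \<open>Without such a zero, eta would be subpolynomial on a line strictly left of 1/2, against
  the mean square bound.\<close>

lemma riemann_zeta_has_zero:
  assumes \<beta>: "\<beta> < 1 / 2"
  shows "\<exists>s. Re s > \<beta> \<and> s \<noteq> 1 \<and> riemann_zeta s = 0"
proof (rule ccontr)
  assume no_zero: "\<not> ?thesis"
  \<comment> \<open>Raising \<beta> to at least 1/4 only shrinks the supposed zero-free half plane
    and makes its edge positive.\<close>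
  define \<beta>' where "\<beta>' = max \<beta> (1 / 4)"
  define \<sigma> where "\<sigma> = (\<beta>' + 1 / 2) / 2"
  \<comment> \<open>Makes 4\<epsilon> half of 1 - 2\<sigma>.\<close>
  define \<epsilon> where "\<epsilon> = (1 - 2 * \<sigma>) / 8"
  have \<sigma>: "\<beta>' < \<sigma>" "\<sigma> < 1 / 2" "0 < \<sigma>" "\<beta>' > 0" using \<beta> by (auto simp: \<beta>'_def \<sigma>_def max_def)
  have \<epsilon>: "0 < \<epsilon>" "4 * \<epsilon> < 1 - 2 * \<sigma>" using \<sigma> by (auto simp: \<epsilon>_def)
  obtain T0 where T0: "\<And>t. \<bar>t\<bar> \<ge> T0 \<Longrightarrow> norm (riemann_zeta (Complex \<sigma> t)) \<le> \<bar>t\<bar> powr \<epsilon>"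
    by (rule riemann_zeta_subpolynomial[of \<beta>' \<sigma> \<epsilon>]) (use no_zero \<sigma> \<epsilon> in \<open>auto simp: \<beta>'_def\<close>)
  define \<eta> where "\<eta> t = dirichlet_series eta_coeff (Complex \<sigma> t)" for t
  have large: "norm (\<eta> t) \<le> 3 * (1 + \<bar>t\<bar>) powr \<epsilon>" if "\<bar>t\<bar> \<ge> T0" for t
  proof -
    have "norm (1 - 2 powr (1 - Complex \<sigma> t)) \<le> 1 + norm (2 powr (1 - Complex \<sigma> t) :: complex)"
      using norm_triangle_ineq4[of 1 "2 powr (1 - Complex \<sigma> t)"] by simp
    also have "norm (2 powr (1 - Complex \<sigma> t) :: complex) = 2 powr (1 - \<sigma>)"
      by (subst norm_powr_real_powr) auto
    also have "2 powr (1 - \<sigma>) \<le> 2 powr 1" using \<sigma> by (intro powr_mono) auto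
    finally have "norm (1 - 2 powr (1 - Complex \<sigma> t)) \<le> 3" by simp
    moreover have "\<bar>t\<bar> powr \<epsilon> \<le> (1 + \<bar>t\<bar>) powr \<epsilon>" using \<epsilon> by (intro powr_mono2) auto
    ultimately show ?thesis
      using \<sigma> T0[OF that] unfolding \<eta>_def
      by (subst eta_eq_zeta) (auto simp: norm_mult complex_eq_iff intro!: mult_mono)
  qed
  \<comment> \<open>The remaining t form a bounded range, covered by compactness; \<open>T0\<close>
    carries no sign condition, hence its absolute value.\<close>
  have "continuous_on {- \<bar>T0\<bar>..\<bar>T0\<bar>} \<eta>"
    unfolding \<eta>_def
    by (rule continuous_on_compose2[OF holomorphic_on_imp_continuous_on[OF dirichlet_series_holomorphic[OF eta_coeff_partial_sums]]])
       (use \<sigma> in \<open>auto simp: Complex_eq intro!: continuous_intros\<close>)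
  hence "compact (\<eta> ` {- \<bar>T0\<bar>..\<bar>T0\<bar>})" by (intro compact_continuous_image) auto
  then obtain B where B: "\<And>t. t \<in> {- \<bar>T0\<bar>..\<bar>T0\<bar>} \<Longrightarrow> norm (\<eta> t) \<le> B" "B > 0"
    using compact_imp_bounded[THEN bounded_pos[THEN iffD1]] by (metis imageI)
  have "norm (\<eta> t) \<le> (3 + B) * (1 + \<bar>t\<bar>) powr \<epsilon>" for t
  proof (cases "\<bar>t\<bar> \<ge> T0")
    case True
    have "3 * (1 + \<bar>t\<bar>) powr \<epsilon> \<le> (3 + B) * (1 + \<bar>t\<bar>) powr \<epsilon>" using B by (intro mult_right_mono) auto
    thus ?thesis using large[OF True] by linarith
  next
    case False
    hence "t \<in> {- \<bar>T0\<bar>..\<bar>T0\<bar>}" unfolding atLeastAtMost_iff by linarith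
    hence "norm (\<eta> t) \<le> B * 1" using B(1) by simp
    also have "\<dots> \<le> (3 + B) * (1 + \<bar>t\<bar>) powr \<epsilon>"
      using B \<epsilon> by (intro mult_mono ge_one_powr_ge_zero) auto
    finally show ?thesis .
  qed
  thus False unfolding \<eta>_def
    by (intro dirichlet_series_not_subpolynomial[of eta_coeff 1 \<sigma> \<epsilon> "3 + B"] eta_coeff_partial_sums \<sigma> \<epsilon>)
       (auto simp: eta_coeff_def norm_power)
qed

theorem theorem1p3:
  fixes k :: nat and chi :: "nat \<Rightarrow> complex" and f g :: "nat \<Rightarrow> real" and \<alpha> :: real
  assumes "dirichlet_character k chi"
    and "real_character chi"
    and "chi \<noteq> principal_character k"
    and "sign_extension k chi g"
    and "f = (\<lambda>n. (moebius_mu n)\<^sup>2 * g n)"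
    and "\<And>s. Re s > 0 \<Longrightarrow> dirichlet_L chi s = 0 \<Longrightarrow> Re s = 1 / 2"
    and "\<alpha> > 0"
    and "summatory f \<in> o[at_top](\<lambda>x. x powr \<alpha>)"
  shows "\<alpha> \<ge> 1 / 4 \<and> (\<forall>s. Re s > 2 * \<alpha> \<longrightarrow> s \<noteq> 1 \<longrightarrow> riemann_zeta s \<noteq> 0)"
proof -
  have zero_free: "riemann_zeta s \<noteq> 0" if "Re s > 2 * \<alpha>" "s \<noteq> 1" for s
    by (rule riemann_zeta_zero_free[OF assms(1,3-8) that])
  moreover from this have "\<alpha> \<ge> 1 / 4"
    using riemann_zeta_has_zero[of "2 * \<alpha>"] by fastforce
  ultimately show ?thesis by blast
qed

end
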